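(* Let $\mathbf{k}$ be a unitary commutative ring, $(A,Q)$ a Rota-Baxter algebra of weight $\lambda$ over $\mathbf{k}$, $H$ a coalgebra over $\mathbf{k}$, and $M$ a right $H$-comodule with structure map $\delta:M\to M\otimes H$, $\delta(m)=\sum_{(m)}m_{(0)}\otimes h_{(1)}$. (a) The pairs $(\mathrm{Hom}_{\mathbf{k}}(H,A),P)$, with $P(f)=Q\circ f$, and $(\mathrm{End}_A(M\otimes A),\mathcal{Q})$, with $\mathcal{Q}(g)(m\otimes a)=\big((\mathrm{id}_M\otimes Q)(g(m\otimes 1))\big)a$, are Rota-Baxter algebras (of weight $\lambda$). (b) The algebra homomorphism $\phi:\mathrm{Hom}_{\mathbf{k}}(H,A)\to\mathrm{End}_A(M\otimes A)$ defined by $\phi(f)(m\otimes a)=\sum_{(m)}m_{(0)}\otimes f(h_{(1)})a$ is a homomorphism of Rota-Baxter algebras. (c) Equipped with the $\mathbf{k}$-linear operator $p:M\otimes A\to M\otimes A$ defined by $p(m\otimes a)=m\otimes Q(a)$, the pair $(M\otimes A,p)$ becomes an $(\mathrm{End}_A(M\otimes A),\mathcal{Q})$-module.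
   Context: $\otimes=\otimes_{\mathbf{k}}$; algebras are unitary associative over $\mathbf{k}$; a coalgebra $H$ has comultiplication $\Delta:H\to H\otimes H$ and counit $\epsilon:H\to\mathbf{k}$. A right comodule of $H$ is a $\mathbf{k}$-module $M$ together with a linear map $\delta:M\to M\otimes H$ such that $(\delta\otimes 1)\circ\delta=(1\otimes\Delta)\circ\delta$. $\mathrm{Hom}_{\mathbf{k}}(H,A)$ is an algebra under the convolution product $(f_1\ast f_2)(h)=\sum_{(h)}f_1(h_{(1)})f_2(h_{(2)})$, where $\Delta(h)=\sum_{(h)}h_{(1)}\otimes h_{(2)}$. $M\otimes A$ is a right $A$-module by multiplication on the second factor, and $\mathrm{End}_A(M\otimes A)$ is its algebra of right $A$-module endomorphisms under composition. A Rota-Baxter algebra of weight $\lambda\in\mathbf{k}$ is a pair $(R,P)$ with $R$ a $\mathbf{k}$-algebra and $P:R\to R$ $\mathbf{k}$-linear with $P(x)P(y)=P(xP(y))+P(P(x)y)+\lambda P(xy)$ for all $x,y\in R$. A homomorphism $(R,P)\to(R',P')$ of Rota-Baxter algebras of the same weight is a homomorphism $\sigma:R\to R'$ of $\mathbf{k}$-algebras with $P'\circ\sigma=\sigma\circ P$. A (left) $(R,P)$-module is a pair $(N,p)$ with $N$ a left $R$-module and $p:N\to N$ $\mathbf{k}$-linear such that $P(a)p(x)=p(ap(x))+p(P(a)x)+\lambda p(ax)$ for all $a\in R$, $x\in N$.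
   Formalization: In (b), φ is shown to be linear, multiplicative and compatible with the operators for every comodule; that φ preserves the unit is shown only when the coaction is counital, (id⊗ε)δ = id, since it fails for example when δ = 0. *)

theory Defs
  imports "HOL-Algebra.Module" "HOL-Algebra.AbelCoset"
begin

section \<open>Linear and bilinear maps\<close>

definition k_linear ::
  "('k, 'z) ring_scheme \<Rightarrow> ('k, 'm, 'y) module_scheme \<Rightarrow> ('k, 'n, 'x) module_scheme \<Rightarrow> ('m \<Rightarrow> 'n) \<Rightarrow> bool"
  where "k_linear k M N h \<longleftrightarrow>
    h \<in> carrier M \<rightarrow> carrier N \<and>
    (\<forall>x\<in>carrier M. \<forall>y\<in>carrier M. h (x \<oplus>\<^bsub>M\<^esub> y) = h x \<oplus>\<^bsub>N\<^esub> h y) \<and>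
    (\<forall>r\<in>carrier k. \<forall>x\<in>carrier M. h (r \<odot>\<^bsub>M\<^esub> x) = r \<odot>\<^bsub>N\<^esub> h x)"

text \<open>Elements of \<open>Hom\<^sub>k(M,N)\<close> are extensional, so that equality of maps is equality on \<open>M\<close>.\<close>

definition linear_maps ::
  "('k, 'z) ring_scheme \<Rightarrow> ('k, 'm, 'y) module_scheme \<Rightarrow> ('k, 'n, 'x) module_scheme \<Rightarrow> ('m \<Rightarrow> 'n) set"
  where "linear_maps k M N = {h \<in> extensional (carrier M). k_linear k M N h}"

definition k_bilinear ::
  "('k, 'z) ring_scheme \<Rightarrow> ('k, 'm, 'y) module_scheme \<Rightarrow> ('k, 'n, 'x) module_scheme \<Rightarrow>
    ('k, 'p, 'w) module_scheme \<Rightarrow> ('m \<Rightarrow> 'n \<Rightarrow> 'p) \<Rightarrow> bool"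
  where "k_bilinear k M N P b \<longleftrightarrow>
    (\<forall>m\<in>carrier M. k_linear k N P (b m)) \<and>
    (\<forall>n\<in>carrier N. k_linear k M P (\<lambda>m. b m n))"

definition base_module :: "('k, 'z) ring_scheme \<Rightarrow> ('k, 'k) module"
  where "base_module k =
    \<lparr>carrier = carrier k, mult = mult k, one = one k, zero = zero k, add = add k,
     smult = mult k\<rparr>"


section \<open>The tensor product over a commutative ring\<close>

text \<open>The fields \<open>mult\<close> and \<open>one\<close> of a record that is only used as a module are irrelevant.\<close>

definition free_module :: "('k, 'z) ring_scheme \<Rightarrow> 'x set \<Rightarrow> ('k, 'x \<Rightarrow> 'k) module"
  where "free_module k X =
    \<lparr>carrier = {f. (\<forall>x. f x \<in> carrier k) \<and> (\<forall>x. x \<notin> X \<longrightarrow> f x = \<zero>\<^bsub>k\<^esub>) \<and> finite {x. f x \<noteq> \<zero>\<^bsub>k\<^esub>}},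
     mult = undefined, one = undefined,
     zero = (\<lambda>x. \<zero>\<^bsub>k\<^esub>),
     add = (\<lambda>f g x. f x \<oplus>\<^bsub>k\<^esub> g x),
     smult = (\<lambda>r f x. r \<otimes>\<^bsub>k\<^esub> f x)\<rparr>"

definition free_gen :: "('k, 'z) ring_scheme \<Rightarrow> 'x \<Rightarrow> 'x \<Rightarrow> 'k"
  where "free_gen k x = (\<lambda>y. if y = x then \<one>\<^bsub>k\<^esub> else \<zero>\<^bsub>k\<^esub>)"

definition submodule_span :: "('k, 'z) ring_scheme \<Rightarrow> ('k, 'm, 'y) module_scheme \<Rightarrow> 'm set \<Rightarrow> 'm set"
  where "submodule_span k M S = \<Inter>{W. submodule W k M \<and> S \<subseteq> W}"

definition quotient_module :: "('k, 'm, 'y) module_scheme \<Rightarrow> 'm set \<Rightarrow> ('k, 'm set) module"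
  where "quotient_module M W =
    \<lparr>carrier = a_rcosets\<^bsub>M\<^esub> W, mult = undefined, one = undefined,
     zero = W,
     add = set_add M,
     smult = (\<lambda>r X. \<Union>x\<in>X. W +>\<^bsub>M\<^esub> (r \<odot>\<^bsub>M\<^esub> x))\<rparr>"

definition tensor_relators ::
  "('k, 'z) ring_scheme \<Rightarrow> ('k, 'm, 'y) module_scheme \<Rightarrow> ('k, 'n, 'x) module_scheme \<Rightarrow> ('m \<times> 'n \<Rightarrow> 'k) set"
  where "tensor_relators k M N =
    (let F = free_module k (carrier M \<times> carrier N); e = (\<lambda>m n. free_gen k (m, n)) in
      {e (m \<oplus>\<^bsub>M\<^esub> m') n \<ominus>\<^bsub>F\<^esub> (e m n \<oplus>\<^bsub>F\<^esub> e m' n) | m m' n.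
         m \<in> carrier M \<and> m' \<in> carrier M \<and> n \<in> carrier N} \<union>
      {e m (n \<oplus>\<^bsub>N\<^esub> n') \<ominus>\<^bsub>F\<^esub> (e m n \<oplus>\<^bsub>F\<^esub> e m n') | m n n'.
         m \<in> carrier M \<and> n \<in> carrier N \<and> n' \<in> carrier N} \<union>
      {e (r \<odot>\<^bsub>M\<^esub> m) n \<ominus>\<^bsub>F\<^esub> (r \<odot>\<^bsub>F\<^esub> e m n) | r m n.
         r \<in> carrier k \<and> m \<in> carrier M \<and> n \<in> carrier N} \<union>
      {e m (r \<odot>\<^bsub>N\<^esub> n) \<ominus>\<^bsub>F\<^esub> (r \<odot>\<^bsub>F\<^esub> e m n) | r m n.
         r \<in> carrier k \<and> m \<in> carrier M \<and> n \<in> carrier N})"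

definition tensor_kernel ::
  "('k, 'z) ring_scheme \<Rightarrow> ('k, 'm, 'y) module_scheme \<Rightarrow> ('k, 'n, 'x) module_scheme \<Rightarrow> ('m \<times> 'n \<Rightarrow> 'k) set"
  where "tensor_kernel k M N =
    submodule_span k (free_module k (carrier M \<times> carrier N)) (tensor_relators k M N)"

definition tensor_module ::
  "('k, 'z) ring_scheme \<Rightarrow> ('k, 'm, 'y) module_scheme \<Rightarrow> ('k, 'n, 'x) module_scheme \<Rightarrow>
    ('k, ('m \<times> 'n \<Rightarrow> 'k) set) module"
  where "tensor_module k M N =
    quotient_module (free_module k (carrier M \<times> carrier N)) (tensor_kernel k M N)"

definition tensor_elem ::
  "('k, 'z) ring_scheme \<Rightarrow> ('k, 'm, 'y) module_scheme \<Rightarrow> ('k, 'n, 'x) module_scheme \<Rightarrow>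
    'm \<Rightarrow> 'n \<Rightarrow> ('m \<times> 'n \<Rightarrow> 'k) set"
  where "tensor_elem k M N m n =
    tensor_kernel k M N +>\<^bsub>free_module k (carrier M \<times> carrier N)\<^esub> free_gen k (m, n)"

text \<open>The linear map \<open>M \<otimes> N \<rightarrow> P\<close> given on elementary tensors by \<open>m \<otimes> n \<mapsto> b m n\<close>; for
  bilinear \<open>b\<close> it exists and is unique by the theorem \<open>tensor_universal\<close> below.\<close>

definition tensor_lift ::
  "('k, 'z) ring_scheme \<Rightarrow> ('k, 'm, 'y) module_scheme \<Rightarrow> ('k, 'n, 'x) module_scheme \<Rightarrow>
    ('k, 'p, 'w) module_scheme \<Rightarrow> ('m \<Rightarrow> 'n \<Rightarrow> 'p) \<Rightarrow> ('m \<times> 'n \<Rightarrow> 'k) set \<Rightarrow> 'p"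
  where "tensor_lift k M N P b =
    (THE h. h \<in> linear_maps k (tensor_module k M N) P \<and>
       (\<forall>m\<in>carrier M. \<forall>n\<in>carrier N. h (tensor_elem k M N m n) = b m n))"

definition tensor_map ::
  "('k, 'z) ring_scheme \<Rightarrow> ('k, 'm, 'y) module_scheme \<Rightarrow> ('k, 'n, 'x) module_scheme \<Rightarrow>
    ('k, 'p, 'w) module_scheme \<Rightarrow> ('k, 'q, 'v) module_scheme \<Rightarrow> ('m \<Rightarrow> 'p) \<Rightarrow> ('n \<Rightarrow> 'q) \<Rightarrow>
    ('m \<times> 'n \<Rightarrow> 'k) set \<Rightarrow> ('p \<times> 'q \<Rightarrow> 'k) set"
  where "tensor_map k M N P Q f g =
    tensor_lift k M N (tensor_module k P Q) (\<lambda>m n. tensor_elem k P Q (f m) (g n))"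

text \<open>The canonical map \<open>(M \<otimes> N) \<otimes> P \<rightarrow> M \<otimes> (N \<otimes> P)\<close>.\<close>

definition tensor_assoc ::
  "('k, 'z) ring_scheme \<Rightarrow> ('k, 'm, 'y) module_scheme \<Rightarrow> ('k, 'n, 'x) module_scheme \<Rightarrow>
    ('k, 'p, 'w) module_scheme \<Rightarrow>
    (('m \<times> 'n \<Rightarrow> 'k) set \<times> 'p \<Rightarrow> 'k) set \<Rightarrow> ('m \<times> ('n \<times> 'p \<Rightarrow> 'k) set \<Rightarrow> 'k) set"
  where "tensor_assoc k M N P =
    (let NP = tensor_module k N P; T = tensor_module k M NP in
      tensor_lift k (tensor_module k M N) P T
        (\<lambda>t p. tensor_lift k M N T (\<lambda>m n. tensor_elem k M NP m (tensor_elem k N P n p)) t))"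


subsection \<open>The universal property\<close>

lemma k_linearD:
  assumes "k_linear k M N h"
  shows "x \<in> carrier M \<Longrightarrow> h x \<in> carrier N"
    and "x \<in> carrier M \<Longrightarrow> y \<in> carrier M \<Longrightarrow> h (x \<oplus>\<^bsub>M\<^esub> y) = h x \<oplus>\<^bsub>N\<^esub> h y"
    and "r \<in> carrier k \<Longrightarrow> x \<in> carrier M \<Longrightarrow> h (r \<odot>\<^bsub>M\<^esub> x) = r \<odot>\<^bsub>N\<^esub> h x"
  using assms by (auto simp: k_linear_def)

lemma (in module) minus_eq_zero:
  assumes "x \<in> carrier M" "y \<in> carrier M"
  shows "x \<ominus>\<^bsub>M\<^esub> y = \<zero>\<^bsub>M\<^esub> \<longleftrightarrow> x = y"
proof
  assume "x \<ominus>\<^bsub>M\<^esub> y = \<zero>\<^bsub>M\<^esub>"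
  then show "x = y" using assms M.add.inv_solve_right[of "\<zero>\<^bsub>M\<^esub>" x y]
    by (simp add: M.minus_eq a_inv_def)
qed (use assms in \<open>simp add: M.minus_eq M.r_neg\<close>)

lemma k_linear_zero_minus:
  assumes M: "module k M" and N: "module k N" and h: "k_linear k M N h"
  shows "h \<zero>\<^bsub>M\<^esub> = \<zero>\<^bsub>N\<^esub>"
    and "x \<in> carrier M \<Longrightarrow> h (\<ominus>\<^bsub>M\<^esub> x) = \<ominus>\<^bsub>N\<^esub> h x"
    and "x \<in> carrier M \<Longrightarrow> y \<in> carrier M \<Longrightarrow> h (x \<ominus>\<^bsub>M\<^esub> y) = h x \<ominus>\<^bsub>N\<^esub> h y"
proof -
  interpret M: module k M by fact
  interpret N: module k N by fact
  interpret abelian_group_hom M N h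
    using k_linearD[OF h]
    by (intro abelian_group_homI M.abelian_group_axioms N.abelian_group_axioms)
      (auto simp: group_hom_def group_hom_axioms_def hom_def M.a_group N.a_group)
  show "h \<zero>\<^bsub>M\<^esub> = \<zero>\<^bsub>N\<^esub>" by simp
  show "x \<in> carrier M \<Longrightarrow> h (\<ominus>\<^bsub>M\<^esub> x) = \<ominus>\<^bsub>N\<^esub> h x" by simp
  show "x \<in> carrier M \<Longrightarrow> y \<in> carrier M \<Longrightarrow> h (x \<ominus>\<^bsub>M\<^esub> y) = h x \<ominus>\<^bsub>N\<^esub> h y"
    by (simp add: a_minus_def)
qed

lemma free_module_simps [simp]:
  "\<zero>\<^bsub>free_module k X\<^esub> = (\<lambda>x. \<zero>\<^bsub>k\<^esub>)"
  "f \<oplus>\<^bsub>free_module k X\<^esub> g = (\<lambda>x. f x \<oplus>\<^bsub>k\<^esub> g x)"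
  "r \<odot>\<^bsub>free_module k X\<^esub> f = (\<lambda>x. r \<otimes>\<^bsub>k\<^esub> f x)"
  by (simp_all add: free_module_def)

lemma free_module_carrier:
  "f \<in> carrier (free_module k X) \<longleftrightarrow>
    (\<forall>x. f x \<in> carrier k) \<and> (\<forall>x. x \<notin> X \<longrightarrow> f x = \<zero>\<^bsub>k\<^esub>) \<and> finite {x. f x \<noteq> \<zero>\<^bsub>k\<^esub>}"
  by (simp add: free_module_def)

lemma free_module_module:
  fixes k (structure)
  assumes "cring k"
  shows "module k (free_module k X)"
proof -
  interpret cring k by fact
  show ?thesis
  proof (rule moduleI)
    show "abelian_group (free_module k X)"
    proof (rule abelian_groupI)
      fix f g assume f: "f \<in> carrier (free_module k X)" and g: "g \<in> carrier (free_module k X)"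
      have "{x. f x \<oplus> g x \<noteq> \<zero>} \<subseteq> {x. f x \<noteq> \<zero>} \<union> {x. g x \<noteq> \<zero>}" by auto
      with f g show "f \<oplus>\<^bsub>free_module k X\<^esub> g \<in> carrier (free_module k X)"
        by (auto simp: free_module_carrier dest: finite_subset)
    next
      fix f assume f: "f \<in> carrier (free_module k X)"
      have "{x. \<ominus> f x \<noteq> \<zero>} \<subseteq> {x. f x \<noteq> \<zero>}" by auto
      with f have "(\<lambda>x. \<ominus> f x) \<in> carrier (free_module k X)"
        by (auto simp: free_module_carrier dest: finite_subset)
      with f show "\<exists>g\<in>carrier (free_module k X). g \<oplus>\<^bsub>free_module k X\<^esub> f = \<zero>\<^bsub>free_module k X\<^esub>"
        by (intro bexI[of _ "\<lambda>x. \<ominus> f x"]) (auto simp: free_module_carrier l_neg)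
    qed (auto simp: free_module_carrier a_ac)
  next
    fix r f assume r: "r \<in> carrier k" and f: "f \<in> carrier (free_module k X)"
    have "{x. r \<otimes> f x \<noteq> \<zero>} \<subseteq> {x. f x \<noteq> \<zero>}" using r by auto
    with r f show "r \<odot>\<^bsub>free_module k X\<^esub> f \<in> carrier (free_module k X)"
      by (auto simp: free_module_carrier dest: finite_subset)
  qed (auto simp: free_module_carrier l_distr r_distr m_assoc assms)
qed

lemma free_gen_closed:
  assumes "cring k" "x \<in> X"
  shows "free_gen k x \<in> carrier (free_module k X)"
proof -
  interpret cring k by fact
  have "{y. free_gen k x y \<noteq> \<zero>\<^bsub>k\<^esub>} \<subseteq> {x}" by (auto simp: free_gen_def)
  then show ?thesis using assms(2)
    by (auto simp: free_module_carrier intro: finite_subset) (auto simp: free_gen_def)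
qed

lemma free_module_induct [consumes 2, case_names zero step]:
  fixes k (structure)
  assumes "cring k" and f: "f \<in> carrier (free_module k X)"
    and zero: "Pr (\<lambda>x. \<zero>)"
    and step: "\<And>r x g. \<lbrakk>r \<in> carrier k; x \<in> X; g \<in> carrier (free_module k X); Pr g\<rbrakk> \<Longrightarrow>
      Pr (\<lambda>y. r \<otimes> free_gen k x y \<oplus> g y)"
  shows "Pr f"
proof -
  interpret cring k by fact
  have "finite S \<Longrightarrow> f \<in> carrier (free_module k X) \<Longrightarrow> {x. f x \<noteq> \<zero>} \<subseteq> S \<Longrightarrow> Pr f" for S f
  proof (induction S arbitrary: f rule: finite_induct)
    case empty
    then have "f = (\<lambda>x. \<zero>)" by auto
    then show ?case using zero by simp
  next
    case (insert a S)
    show ?case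
    proof (cases "a \<in> X")
      case True
      let ?g = "\<lambda>x. if x = a then \<zero> else f x"
      have sub: "{x. ?g x \<noteq> \<zero>} \<subseteq> S" using insert.prems by auto
      have "{x. ?g x \<noteq> \<zero>} \<subseteq> {x. f x \<noteq> \<zero>}" by auto
      then have g: "?g \<in> carrier (free_module k X)"
        using insert.prems by (auto simp: free_module_carrier intro: finite_subset)
      have fc: "f x \<in> carrier k" for x using insert.prems by (auto simp: free_module_carrier)
      have "Pr (\<lambda>y. f a \<otimes> free_gen k a y \<oplus> ?g y)"
        by (rule step[OF fc True g insert.IH[OF g sub]])
      also have "(\<lambda>y. f a \<otimes> free_gen k a y \<oplus> ?g y) = f"
        using fc by (auto simp: free_gen_def fun_eq_iff)
      finally show ?thesis .
    next
      case False
      then have "f a = \<zero>" using insert.prems by (auto simp: free_module_carrier)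
      then have "{x. f x \<noteq> \<zero>} \<subseteq> S" using insert.prems by auto
      then show ?thesis using insert by blast
    qed
  qed
  with f show ?thesis by (auto simp: free_module_carrier)
qed

lemma free_module_extend:
  fixes k (structure)
  assumes P: "module k P" and v: "\<And>x. x \<in> X \<Longrightarrow> v x \<in> carrier P"
  shows "\<exists>h. k_linear k (free_module k X) P h \<and> (\<forall>x\<in>X. h (free_gen k x) = v x)"
proof -
  interpret P: module k P by fact
  let ?F = "free_module k X"
  define h where "h f = (\<Oplus>\<^bsub>P\<^esub>x\<in>{x. f x \<noteq> \<zero>}. f x \<odot>\<^bsub>P\<^esub> v x)" for f
  have vc: "f x \<odot>\<^bsub>P\<^esub> v x \<in> carrier P" if "f \<in> carrier ?F" "x \<in> X" for f x
    using that v by (auto simp: free_module_carrier)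
  have h_eq: "h f = (\<Oplus>\<^bsub>P\<^esub>x\<in>S. f x \<odot>\<^bsub>P\<^esub> v x)"
    if f: "f \<in> carrier ?F" and S: "finite S" "S \<subseteq> X" "{x. f x \<noteq> \<zero>} \<subseteq> S" for f S
    unfolding h_def
    using vc[OF f] S v by (intro P.add.finprod_mono_neutral_cong_left) auto
  have supp: "finite {x. f x \<noteq> \<zero>}" "{x. f x \<noteq> \<zero>} \<subseteq> X" if "f \<in> carrier ?F" for f
    using that by (auto simp: free_module_carrier)
  interpret F: module k ?F by (rule free_module_module) (rule P.R.cring_axioms)
  have "k_linear k ?F P h"
    unfolding k_linear_def
  proof (intro conjI ballI)
    show "h \<in> carrier ?F \<rightarrow> carrier P"
      using vc supp by (force simp: h_def intro!: P.finsum_closed)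
  next
    fix f g assume f: "f \<in> carrier ?F" and g: "g \<in> carrier ?F"
    let ?S = "{x. f x \<noteq> \<zero>} \<union> {x. g x \<noteq> \<zero>}"
    have S: "finite ?S" "?S \<subseteq> X" using supp[OF f] supp[OF g] by auto
    have fg: "f \<oplus>\<^bsub>?F\<^esub> g \<in> carrier ?F" using f g by (rule F.M.a_closed)
    have "h (f \<oplus>\<^bsub>?F\<^esub> g) = (\<Oplus>\<^bsub>P\<^esub>x\<in>?S. (f \<oplus>\<^bsub>?F\<^esub> g) x \<odot>\<^bsub>P\<^esub> v x)"
      by (rule h_eq[OF fg S]) auto
    also have "\<dots> = (\<Oplus>\<^bsub>P\<^esub>x\<in>?S. f x \<odot>\<^bsub>P\<^esub> v x \<oplus>\<^bsub>P\<^esub> g x \<odot>\<^bsub>P\<^esub> v x)"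
    proof (rule P.finsum_cong')
      show "(\<lambda>x. f x \<odot>\<^bsub>P\<^esub> v x \<oplus>\<^bsub>P\<^esub> g x \<odot>\<^bsub>P\<^esub> v x) \<in> ?S \<rightarrow> carrier P"
        using vc[OF f] vc[OF g] S by auto
      fix x assume "x \<in> ?S"
      then have "v x \<in> carrier P" using S v by auto
      then show "(f \<oplus>\<^bsub>?F\<^esub> g) x \<odot>\<^bsub>P\<^esub> v x = f x \<odot>\<^bsub>P\<^esub> v x \<oplus>\<^bsub>P\<^esub> g x \<odot>\<^bsub>P\<^esub> v x"
        using f g by (auto simp: free_module_carrier P.smult_l_distr)
    qed simp
    also have "\<dots> = (\<Oplus>\<^bsub>P\<^esub>x\<in>?S. f x \<odot>\<^bsub>P\<^esub> v x) \<oplus>\<^bsub>P\<^esub> (\<Oplus>\<^bsub>P\<^esub>x\<in>?S. g x \<odot>\<^bsub>P\<^esub> v x)"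
      using vc[OF f] vc[OF g] S by (intro P.finsum_addf) auto
    also have "(\<Oplus>\<^bsub>P\<^esub>x\<in>?S. f x \<odot>\<^bsub>P\<^esub> v x) = h f" using h_eq[OF f S] by auto
    also have "(\<Oplus>\<^bsub>P\<^esub>x\<in>?S. g x \<odot>\<^bsub>P\<^esub> v x) = h g" using h_eq[OF g S] by auto
    finally show "h (f \<oplus>\<^bsub>?F\<^esub> g) = h f \<oplus>\<^bsub>P\<^esub> h g" .
  next
    fix r f assume r: "r \<in> carrier k" and f: "f \<in> carrier ?F"
    let ?S = "{x. f x \<noteq> \<zero>}"
    have S: "finite ?S" "?S \<subseteq> X" using supp[OF f] by auto
    have "h (r \<odot>\<^bsub>?F\<^esub> f) = (\<Oplus>\<^bsub>P\<^esub>x\<in>?S. (r \<odot>\<^bsub>?F\<^esub> f) x \<odot>\<^bsub>P\<^esub> v x)"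
      by (rule h_eq[OF F.smult_closed[OF r f] S]) (use r in auto)
    also have "\<dots> = (\<Oplus>\<^bsub>P\<^esub>x\<in>?S. r \<odot>\<^bsub>P\<^esub> (f x \<odot>\<^bsub>P\<^esub> v x))"
    proof (rule P.finsum_cong')
      show "(\<lambda>x. r \<odot>\<^bsub>P\<^esub> (f x \<odot>\<^bsub>P\<^esub> v x)) \<in> ?S \<rightarrow> carrier P" using vc[OF f] S r by auto
      fix x assume "x \<in> ?S"
      then have "v x \<in> carrier P" using S v by auto
      then show "(r \<odot>\<^bsub>?F\<^esub> f) x \<odot>\<^bsub>P\<^esub> v x = r \<odot>\<^bsub>P\<^esub> (f x \<odot>\<^bsub>P\<^esub> v x)"
        using f r by (auto simp: free_module_carrier P.smult_assoc1)
    qed simp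
    also have "\<dots> = r \<odot>\<^bsub>P\<^esub> h f"
      unfolding h_def using vc[OF f] S r by (intro P.finsum_smult_ldistr[symmetric]) auto
    finally show "h (r \<odot>\<^bsub>?F\<^esub> f) = r \<odot>\<^bsub>P\<^esub> h f" .
  qed
  moreover have "h (free_gen k x) = v x" if x: "x \<in> X" for x
  proof -
    have "h (free_gen k x) = (\<Oplus>\<^bsub>P\<^esub>y\<in>{x}. free_gen k x y \<odot>\<^bsub>P\<^esub> v y)"
      by (rule h_eq[OF free_gen_closed[OF P.R.cring_axioms x]]) (use x in \<open>auto simp: free_gen_def\<close>)
    also have "\<dots> = v x" using v[OF x] by (simp add: free_gen_def)
    finally show ?thesis .
  qed
  ultimately show ?thesis by blast
qed

lemma submodule_span_submodule:
  assumes "module k M" "S \<subseteq> carrier M"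
  shows "submodule (submodule_span k M S) k M" "S \<subseteq> submodule_span k M S"
proof -
  interpret module k M by fact
  have c: "submodule (carrier M) k M" by (rule carrier_is_submodule)
  have E: "\<And>W. submodule W k M \<Longrightarrow> \<zero>\<^bsub>M\<^esub> \<in> W"
    by (metis subgroup.one_closed submodule.axioms(1) monoid.simps(2))
  show "submodule (submodule_span k M S) k M"
    unfolding submodule_span_def
  proof (rule submoduleI)
    show "\<Inter>{W. submodule W k M \<and> S \<subseteq> W} \<subseteq> carrier M" using c assms(2) by blast
  qed (use E in \<open>simp_all add: submoduleE\<close>)
  show "S \<subseteq> submodule_span k M S" unfolding submodule_span_def by auto
qed

context
  fixes k :: "('k, 'z) ring_scheme" and F :: "('k, 'm, 'y) module_scheme" and W
  assumes F: "module k F" and W: "submodule W k F"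
begin

interpretation F: module k F by (rule F)

interpretation W: abelian_subgroup W F
  using submodule.axioms(1)[OF W] F.abelian_group_axioms
  by (intro abelian_subgroupI3 additive_subgroupI)

lemma quotient_carrier: "X \<in> carrier (quotient_module F W) \<longleftrightarrow> (\<exists>x\<in>carrier F. X = W +>\<^bsub>F\<^esub> x)"
  by (auto simp: quotient_module_def A_RCOSETS_def')

lemma quotient_add: "x \<in> carrier F \<Longrightarrow> y \<in> carrier F \<Longrightarrow>
    (W +>\<^bsub>F\<^esub> x) \<oplus>\<^bsub>quotient_module F W\<^esub> (W +>\<^bsub>F\<^esub> y) = W +>\<^bsub>F\<^esub> (x \<oplus>\<^bsub>F\<^esub> y)"
  by (simp add: quotient_module_def W.a_rcos_sum)

lemma quotient_zero: "\<zero>\<^bsub>quotient_module F W\<^esub> = W +>\<^bsub>F\<^esub> \<zero>\<^bsub>F\<^esub>"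
  by (simp add: quotient_module_def W.a_subset)


lemma quotient_eq_iff:
  assumes "x \<in> carrier F" "y \<in> carrier F"
  shows "W +>\<^bsub>F\<^esub> x = W +>\<^bsub>F\<^esub> y \<longleftrightarrow> x \<ominus>\<^bsub>F\<^esub> y \<in> W"
proof -
  have "x \<in> W +>\<^bsub>F\<^esub> y \<longleftrightarrow> x \<ominus>\<^bsub>F\<^esub> y \<in> W"
    using assms by (simp add: W.a_rcos_module a_minus_def)
  moreover have "W +>\<^bsub>F\<^esub> x = W +>\<^bsub>F\<^esub> y \<longleftrightarrow> x \<in> W +>\<^bsub>F\<^esub> y"
    using W.a_repr_independence'[OF _ assms(2), of x] W.a_rcos_self[OF assms(1)] by auto
  ultimately show ?thesis by simp
qed

lemma quotient_smult:
  assumes r: "r \<in> carrier k" and x: "x \<in> carrier F"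
  shows "r \<odot>\<^bsub>quotient_module F W\<^esub> (W +>\<^bsub>F\<^esub> x) = W +>\<^bsub>F\<^esub> (r \<odot>\<^bsub>F\<^esub> x)"
proof -
  have "W +>\<^bsub>F\<^esub> (r \<odot>\<^bsub>F\<^esub> y) = W +>\<^bsub>F\<^esub> (r \<odot>\<^bsub>F\<^esub> x)" if y: "y \<in> W +>\<^bsub>F\<^esub> x" for y
  proof -
    have yc: "y \<in> carrier F" using W.a_elemrcos_carrier[OF x y] .
    have "r \<odot>\<^bsub>F\<^esub> (y \<oplus>\<^bsub>F\<^esub> \<ominus>\<^bsub>F\<^esub> x) \<in> W"
      by (rule submodule.smult_closed[OF W r W.a_rcos_module_imp[OF x y]])
    also have "r \<odot>\<^bsub>F\<^esub> (y \<oplus>\<^bsub>F\<^esub> \<ominus>\<^bsub>F\<^esub> x) = r \<odot>\<^bsub>F\<^esub> y \<ominus>\<^bsub>F\<^esub> r \<odot>\<^bsub>F\<^esub> x"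
      using r x yc by (simp only: F.smult_r_distr F.smult_r_minus F.M.a_inv_closed F.M.minus_eq)
    finally show ?thesis
      using quotient_eq_iff[OF F.smult_closed[OF r yc] F.smult_closed[OF r x]] by (rule iffD2[rotated])
  qed
  then have "(\<Union>y\<in>W +>\<^bsub>F\<^esub> x. W +>\<^bsub>F\<^esub> (r \<odot>\<^bsub>F\<^esub> y)) = (\<Union>y\<in>W +>\<^bsub>F\<^esub> x. W +>\<^bsub>F\<^esub> (r \<odot>\<^bsub>F\<^esub> x))"
    by (intro SUP_cong refl)
  also have "\<dots> = W +>\<^bsub>F\<^esub> (r \<odot>\<^bsub>F\<^esub> x)"
    using W.a_rcos_self[OF x] by blast
  finally show ?thesis by (simp only: quotient_module_def module.simps)
qed

lemma quotient_module_module: "module k (quotient_module F W)"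
proof (rule moduleI)
  show "cring k" by (rule F.R.cring_axioms)
  show "abelian_group (quotient_module F W)"
  proof (rule abelian_groupI)
    fix X assume "X \<in> carrier (quotient_module F W)"
    then obtain x where x: "x \<in> carrier F" "X = W +>\<^bsub>F\<^esub> x" by (auto simp: quotient_carrier)
    then have "(W +>\<^bsub>F\<^esub> (\<ominus>\<^bsub>F\<^esub> x)) \<oplus>\<^bsub>quotient_module F W\<^esub> X = \<zero>\<^bsub>quotient_module F W\<^esub>"
      by (simp add: quotient_add quotient_zero F.M.l_neg)
    then show "\<exists>Y\<in>carrier (quotient_module F W). Y \<oplus>\<^bsub>quotient_module F W\<^esub> X = \<zero>\<^bsub>quotient_module F W\<^esub>"
      using x by (intro bexI[of _ "W +>\<^bsub>F\<^esub> (\<ominus>\<^bsub>F\<^esub> x)"])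
        (auto simp: quotient_carrier intro: F.M.a_inv_closed)
  qed (auto simp: quotient_carrier quotient_add quotient_zero F.M.a_ac)
qed (auto simp: quotient_carrier quotient_add quotient_smult
      F.smult_l_distr F.smult_r_distr F.smult_assoc1)

lemma quotient_factor:
  assumes P: "module k P" and h: "k_linear k F P h" and ker: "\<And>x. x \<in> W \<Longrightarrow> h x = \<zero>\<^bsub>P\<^esub>"
  shows "\<exists>g\<in>linear_maps k (quotient_module F W) P. \<forall>x\<in>carrier F. g (W +>\<^bsub>F\<^esub> x) = h x"
proof -
  interpret P: module k P by fact
  define g where "g = (\<lambda>X\<in>carrier (quotient_module F W). h (SOME x. x \<in> X))"
  have g: "g (W +>\<^bsub>F\<^esub> x) = h x" if x: "x \<in> carrier F" for x
  proof -
    define y where "y = (SOME y. y \<in> W +>\<^bsub>F\<^esub> x)"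
    have y: "y \<in> W +>\<^bsub>F\<^esub> x" unfolding y_def using W.a_rcos_self[OF x] by (rule someI)
    have yc: "y \<in> carrier F" using W.a_elemrcos_carrier[OF x y] .
    have "h (y \<ominus>\<^bsub>F\<^esub> x) = \<zero>\<^bsub>P\<^esub>"
      by (rule ker) (use W.a_rcos_module_imp[OF x y] in \<open>simp add: a_minus_def\<close>)
    then have "h y = h x"
      using k_linear_zero_minus(3)[OF F P h yc x] k_linearD(1)[OF h] x yc
      by (simp add: P.minus_eq_zero)
    then show ?thesis using x by (auto simp: g_def y_def quotient_carrier)
  qed
  have "k_linear k (quotient_module F W) P g"
    using g k_linearD[OF h]
    by (auto simp: k_linear_def quotient_carrier quotient_add quotient_smult)
  then show ?thesis using g by (auto simp: linear_maps_def g_def intro!: bexI[of _ g])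
qed

end

lemma tensor_relators_closed:
  assumes "module k M" "module k N"
  shows "tensor_relators k M N \<subseteq> carrier (free_module k (carrier M \<times> carrier N))"
proof -
  interpret M: module k M by fact
  interpret N: module k N by fact
  let ?F = "free_module k (carrier M \<times> carrier N)"
  interpret F: module k ?F by (rule free_module_module) (rule M.R.cring_axioms)
  have e: "free_gen k (m, n) \<in> carrier ?F" if "m \<in> carrier M" "n \<in> carrier N" for m n
    using that by (intro free_gen_closed M.R.cring_axioms) auto
  show ?thesis
    unfolding tensor_relators_def Let_def
    by (auto simp del: free_module_simps intro!: F.M.minus_closed F.M.a_closed F.smult_closed e)
qed

lemma tensor_module_module:
  assumes "module k M" "module k N"
  shows "module k (tensor_module k M N)"
  unfolding tensor_module_def tensor_kernel_def
  by (intro quotient_module_module submodule_span_submodule free_module_module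
      tensor_relators_closed assms module.axioms(1)[OF assms(1)])

theorem tensor_universal:
  assumes M: "module k M" and N: "module k N" and P: "module k P" and b: "k_bilinear k M N P b"
  shows "\<exists>!h. h \<in> linear_maps k (tensor_module k M N) P \<and>
    (\<forall>m\<in>carrier M. \<forall>n\<in>carrier N. h (tensor_elem k M N m n) = b m n)"
proof -
  interpret M: module k M by fact
  interpret N: module k N by fact
  interpret P: module k P by fact
  let ?X = "carrier M \<times> carrier N" and ?T = "tensor_module k M N"
  let ?F = "free_module k ?X" and ?W = "tensor_kernel k M N"
  have F: "module k ?F" by (rule free_module_module) (rule M.R.cring_axioms)
  interpret F: module k ?F by (rule F)
  have L1: "k_linear k M P (\<lambda>m. b m n)" if "n \<in> carrier N" for n
    using b that by (simp add: k_bilinear_def)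
  have L2: "k_linear k N P (b m)" if "m \<in> carrier M" for m
    using b that by (simp add: k_bilinear_def)
  have bD: "b m n \<in> carrier P" if "m \<in> carrier M" "n \<in> carrier N" for m n
    using k_linearD(1)[OF L2] that by auto
  have W: "submodule ?W k ?F"
    unfolding tensor_kernel_def by (intro submodule_span_submodule F tensor_relators_closed M N)
  have e: "free_gen k x \<in> carrier ?F" if "x \<in> ?X" for x
    using that by (intro free_gen_closed M.R.cring_axioms) auto
  obtain h where h: "k_linear k ?F P h" and hb: "\<forall>x\<in>?X. h (free_gen k x) = (case x of (m, n) \<Rightarrow> b m n)"
    using free_module_extend[OF P, of ?X "\<lambda>(m, n). b m n"] bD by auto
  note hm = k_linear_zero_minus[OF F P h]
  note hD = k_linearD[OF h]
  have ker: "submodule {x \<in> carrier ?F. h x = \<zero>\<^bsub>P\<^esub>} k ?F"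
    by (rule F.submoduleI) (auto simp del: free_module_simps simp: hm hD)
  have "h x = \<zero>\<^bsub>P\<^esub>" if x: "x \<in> tensor_relators k M N" for x
  proof -
    have zero: "h (x \<ominus>\<^bsub>?F\<^esub> y) = \<zero>\<^bsub>P\<^esub>"
      if "x \<in> carrier ?F" "y \<in> carrier ?F" "h x = h y" for x y
      using that hm(3) hD(1) by (simp add: P.M.minus_eq P.M.r_neg)
    have lin1: "b (m \<oplus>\<^bsub>M\<^esub> m') n = b m n \<oplus>\<^bsub>P\<^esub> b m' n"
      if "m \<in> carrier M" "m' \<in> carrier M" "n \<in> carrier N" for m m' n
      using k_linearD(2)[OF L1] that by auto
    have lin2: "b m (n \<oplus>\<^bsub>N\<^esub> n') = b m n \<oplus>\<^bsub>P\<^esub> b m n'"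
      if "m \<in> carrier M" "n \<in> carrier N" "n' \<in> carrier N" for m n n'
      using k_linearD(2)[OF L2] that by auto
    have lin3: "b (r \<odot>\<^bsub>M\<^esub> m) n = r \<odot>\<^bsub>P\<^esub> b m n"
      if "r \<in> carrier k" "m \<in> carrier M" "n \<in> carrier N" for r m n
      using k_linearD(3)[OF L1] that by auto
    have lin4: "b m (r \<odot>\<^bsub>N\<^esub> n) = r \<odot>\<^bsub>P\<^esub> b m n"
      if "r \<in> carrier k" "m \<in> carrier M" "n \<in> carrier N" for r m n
      using k_linearD(3)[OF L2] that by auto
    show ?thesis
      using x unfolding tensor_relators_def Let_def
      by (auto simp del: free_module_simps simp: e hb hD lin1 lin2 lin3 lin4 intro!: zero)
  qed
  then have "tensor_relators k M N \<subseteq> {x \<in> carrier ?F. h x = \<zero>\<^bsub>P\<^esub>}"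
    using tensor_relators_closed[OF M N] by auto
  with ker have "?W \<subseteq> {x \<in> carrier ?F. h x = \<zero>\<^bsub>P\<^esub>}"
    unfolding tensor_kernel_def submodule_span_def by auto
  then obtain g where g: "g \<in> linear_maps k ?T P" and gh: "\<And>x. x \<in> carrier ?F \<Longrightarrow> g (?W +>\<^bsub>?F\<^esub> x) = h x"
    using quotient_factor[OF F W P h] unfolding tensor_module_def by auto
  show ?thesis
  proof (rule ex1I[of _ g])
    show "g \<in> linear_maps k ?T P \<and> (\<forall>m\<in>carrier M. \<forall>n\<in>carrier N. g (tensor_elem k M N m n) = b m n)"
      using g gh e hb by (auto simp: tensor_elem_def)
  next
    fix g' assume g': "g' \<in> linear_maps k ?T P \<and>
      (\<forall>m\<in>carrier M. \<forall>n\<in>carrier N. g' (tensor_elem k M N m n) = b m n)"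
    have lg: "k_linear k ?T P g" "k_linear k ?T P g'" using g g' by (auto simp: linear_maps_def)
    have T: "module k ?T" by (rule tensor_module_module[OF M N])
    have tc: "?W +>\<^bsub>?F\<^esub> x \<in> carrier ?T" if "x \<in> carrier ?F" for x
      using that by (auto simp: tensor_module_def quotient_carrier[OF F W])
    have eq: "g' (?W +>\<^bsub>?F\<^esub> f) = g (?W +>\<^bsub>?F\<^esub> f)" if "f \<in> carrier ?F" for f
      using M.R.cring_axioms that
    proof (induction rule: free_module_induct)
      case zero
      have "?W +>\<^bsub>?F\<^esub> (\<lambda>x. \<zero>\<^bsub>k\<^esub>) = \<zero>\<^bsub>?T\<^esub>"
        unfolding tensor_module_def by (simp add: quotient_zero[OF F W])
      then show ?case using lg[THEN k_linear_zero_minus(1)[OF T P]] by simp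
    next
      case (step r x f)
      let ?e = "?W +>\<^bsub>?F\<^esub> free_gen k x" and ?f = "?W +>\<^bsub>?F\<^esub> f"
      have ec: "free_gen k x \<in> carrier ?F" using e step by simp
      have c: "?e \<in> carrier ?T" "?f \<in> carrier ?T" using tc ec step by simp_all
      have rc: "r \<odot>\<^bsub>?F\<^esub> free_gen k x \<in> carrier ?F"
        using step(1) ec by (rule F.smult_closed)
      have *: "?W +>\<^bsub>?F\<^esub> (\<lambda>y. r \<otimes>\<^bsub>k\<^esub> free_gen k x y \<oplus>\<^bsub>k\<^esub> f y) = r \<odot>\<^bsub>?T\<^esub> ?e \<oplus>\<^bsub>?T\<^esub> ?f"
        unfolding tensor_module_def
        by (simp only: quotient_add[OF F W rc step(3)] quotient_smult[OF F W step(1) ec])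
          (simp only: free_module_simps)
      have lin: "j (r \<odot>\<^bsub>?T\<^esub> ?e \<oplus>\<^bsub>?T\<^esub> ?f) = r \<odot>\<^bsub>P\<^esub> j ?e \<oplus>\<^bsub>P\<^esub> j ?f" if "k_linear k ?T P j" for j
        using k_linearD(2)[OF that module.smult_closed[OF T step(1) c(1)] c(2)]
          k_linearD(3)[OF that step(1) c(1)] by simp
      have "g' ?e = g ?e"
        using g' gh[OF ec] hb step(2) by (auto simp: tensor_elem_def)
      then show ?case
        by (simp only: * lin[OF lg(1)] lin[OF lg(2)] step.IH)
    qed
    show "g' = g"
    proof
      fix t show "g' t = g t"
      proof (cases "t \<in> carrier ?T")
        case True
        then show ?thesis using eq by (auto simp: tensor_module_def quotient_carrier[OF F W])
      next
        case False
        then show ?thesis using g g' by (auto simp: linear_maps_def extensional_def)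
      qed
    qed
  qed
qed


section \<open>Algebras, coalgebras, comodules\<close>

text \<open>The locale \<open>algebra\<close> of HOL-Algebra is restricted to commutative algebras.\<close>

locale k_algebra = module k A + ring A
  for k :: "('k, 'z) ring_scheme" and A :: "('k, 'a, 'y) module_scheme" (structure) +
  assumes smult_mult_left: "\<lbrakk>r \<in> carrier k; a \<in> carrier A; b \<in> carrier A\<rbrakk> \<Longrightarrow>
      (r \<odot> a) \<otimes> b = r \<odot> (a \<otimes> b)"
    and smult_mult_right: "\<lbrakk>r \<in> carrier k; a \<in> carrier A; b \<in> carrier A\<rbrakk> \<Longrightarrow>
      a \<otimes> (r \<odot> b) = r \<odot> (a \<otimes> b)"

locale coalgebra = module k H
  for k :: "('k, 'z) ring_scheme" and H :: "('k, 'h, 'y) module_scheme" +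
  fixes \<Delta> :: "'h \<Rightarrow> ('h \<times> 'h \<Rightarrow> 'k) set" and \<epsilon> :: "'h \<Rightarrow> 'k"
  assumes comult_linear: "k_linear k H (tensor_module k H H) \<Delta>"
    and counit_linear: "k_linear k H (base_module k) \<epsilon>"
    and coassoc: "h \<in> carrier H \<Longrightarrow>
      tensor_assoc k H H H (tensor_map k H H (tensor_module k H H) H \<Delta> (\<lambda>x. x) (\<Delta> h)) =
      tensor_map k H H H (tensor_module k H H) (\<lambda>x. x) \<Delta> (\<Delta> h)"
    and counit_left: "h \<in> carrier H \<Longrightarrow> tensor_lift k H H H (\<lambda>x y. \<epsilon> x \<odot>\<^bsub>H\<^esub> y) (\<Delta> h) = h"
    and counit_right: "h \<in> carrier H \<Longrightarrow> tensor_lift k H H H (\<lambda>x y. \<epsilon> y \<odot>\<^bsub>H\<^esub> x) (\<Delta> h) = h"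

text \<open>Compatibility of the coaction with the counit is not part of the definition of a comodule;
  it is the separate predicate \<open>counital_coaction\<close>. Without it the representation
  \<open>comodule_rep\<close> below is multiplicative but need not preserve the unit, e.g. for \<open>\<delta> = 0\<close>.\<close>

locale right_comodule = coalgebra k H \<Delta> \<epsilon> + M: module k M
  for k :: "('k, 'z) ring_scheme" and H :: "('k, 'h, 'y) module_scheme" and \<Delta> \<epsilon>
    and M :: "('k, 'm, 'x) module_scheme" +
  fixes \<delta> :: "'m \<Rightarrow> ('m \<times> 'h \<Rightarrow> 'k) set"
  assumes coaction_linear: "k_linear k M (tensor_module k M H) \<delta>"
    and coaction_coassoc: "m \<in> carrier M \<Longrightarrow>
      tensor_assoc k M H H (tensor_map k M H (tensor_module k M H) H \<delta> (\<lambda>x. x) (\<delta> m)) =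
      tensor_map k M H M (tensor_module k H H) (\<lambda>x. x) \<Delta> (\<delta> m)"

definition counital_coaction ::
  "('k, 'z) ring_scheme \<Rightarrow> ('k, 'h, 'y) module_scheme \<Rightarrow> ('h \<Rightarrow> 'k) \<Rightarrow>
    ('k, 'm, 'x) module_scheme \<Rightarrow> ('m \<Rightarrow> ('m \<times> 'h \<Rightarrow> 'k) set) \<Rightarrow> bool"
  where "counital_coaction k H \<epsilon> M \<delta> \<longleftrightarrow>
    (\<forall>m\<in>carrier M. tensor_lift k M H M (\<lambda>x h. \<epsilon> h \<odot>\<^bsub>M\<^esub> x) (\<delta> m) = m)"


section \<open>Rota-Baxter algebras and modules\<close>

locale rota_baxter_algebra = k_algebra k A
  for k :: "('k, 'z) ring_scheme" and A :: "('k, 'a, 'y) module_scheme" (structure) +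
  fixes weight :: 'k and P :: "'a \<Rightarrow> 'a"
  assumes weight_closed: "weight \<in> carrier k"
    and operator_linear: "k_linear k A A P"
    and rota_baxter: "\<lbrakk>x \<in> carrier A; y \<in> carrier A\<rbrakk> \<Longrightarrow>
      P x \<otimes> P y = P (x \<otimes> P y) \<oplus> P (P x \<otimes> y) \<oplus> weight \<odot> P (x \<otimes> y)"

text \<open>Homomorphisms of not necessarily unital algebras compatible with the operators.\<close>

definition rota_baxter_hom_nonunital ::
  "('k, 'z) ring_scheme \<Rightarrow> ('k, 'a, 'y) module_scheme \<Rightarrow> ('a \<Rightarrow> 'a) \<Rightarrow>
    ('k, 'b, 'x) module_scheme \<Rightarrow> ('b \<Rightarrow> 'b) \<Rightarrow> ('a \<Rightarrow> 'b) \<Rightarrow> bool"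
  where "rota_baxter_hom_nonunital k A P B Q \<sigma> \<longleftrightarrow>
    k_linear k A B \<sigma> \<and>
    (\<forall>x\<in>carrier A. \<forall>y\<in>carrier A. \<sigma> (x \<otimes>\<^bsub>A\<^esub> y) = \<sigma> x \<otimes>\<^bsub>B\<^esub> \<sigma> y) \<and>
    (\<forall>x\<in>carrier A. Q (\<sigma> x) = \<sigma> (P x))"

definition rota_baxter_hom ::
  "('k, 'z) ring_scheme \<Rightarrow> ('k, 'a, 'y) module_scheme \<Rightarrow> ('a \<Rightarrow> 'a) \<Rightarrow>
    ('k, 'b, 'x) module_scheme \<Rightarrow> ('b \<Rightarrow> 'b) \<Rightarrow> ('a \<Rightarrow> 'b) \<Rightarrow> bool"
  where "rota_baxter_hom k A P B Q \<sigma> \<longleftrightarrow>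
    rota_baxter_hom_nonunital k A P B Q \<sigma> \<and> \<sigma> \<one>\<^bsub>A\<^esub> = \<one>\<^bsub>B\<^esub>"

locale rota_baxter_module = rota_baxter_algebra k A weight P + N: module k N
  for k :: "('k, 'z) ring_scheme" and A :: "('k, 'a, 'y) module_scheme" (structure)
    and weight P and N :: "('k, 'n, 'x) module_scheme" +
  fixes act :: "'a \<Rightarrow> 'n \<Rightarrow> 'n" and p :: "'n \<Rightarrow> 'n"
  assumes act_closed: "\<lbrakk>a \<in> carrier A; x \<in> carrier N\<rbrakk> \<Longrightarrow> act a x \<in> carrier N"
    and act_add_left: "\<lbrakk>a \<in> carrier A; b \<in> carrier A; x \<in> carrier N\<rbrakk> \<Longrightarrow>
      act (a \<oplus> b) x = act a x \<oplus>\<^bsub>N\<^esub> act b x"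
    and act_add_right: "\<lbrakk>a \<in> carrier A; x \<in> carrier N; y \<in> carrier N\<rbrakk> \<Longrightarrow>
      act a (x \<oplus>\<^bsub>N\<^esub> y) = act a x \<oplus>\<^bsub>N\<^esub> act a y"
    and act_mult: "\<lbrakk>a \<in> carrier A; b \<in> carrier A; x \<in> carrier N\<rbrakk> \<Longrightarrow>
      act (a \<otimes> b) x = act a (act b x)"
    and act_one: "x \<in> carrier N \<Longrightarrow> act \<one> x = x"
    and act_smult: "\<lbrakk>r \<in> carrier k; a \<in> carrier A; x \<in> carrier N\<rbrakk> \<Longrightarrow>
      act (r \<odot> a) x = r \<odot>\<^bsub>N\<^esub> act a x"
    and module_operator_linear: "k_linear k N N p"
    and module_rota_baxter: "\<lbrakk>a \<in> carrier A; x \<in> carrier N\<rbrakk> \<Longrightarrow>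
      act (P a) (p x) =
      p (act a (p x)) \<oplus>\<^bsub>N\<^esub> p (act (P a) x) \<oplus>\<^bsub>N\<^esub> weight \<odot>\<^bsub>N\<^esub> p (act a x)"


section \<open>The algebras \<open>Hom\<^sub>k(H,A)\<close> and \<open>End\<^sub>A(M \<otimes> A)\<close>\<close>

definition convolution_algebra ::
  "('k, 'z) ring_scheme \<Rightarrow> ('k, 'h, 'y) module_scheme \<Rightarrow> ('h \<Rightarrow> ('h \<times> 'h \<Rightarrow> 'k) set) \<Rightarrow> ('h \<Rightarrow> 'k) \<Rightarrow>
    ('k, 'a, 'x) module_scheme \<Rightarrow> ('k, 'h \<Rightarrow> 'a) module"
  where "convolution_algebra k H \<Delta> \<epsilon> A =
    \<lparr>carrier = linear_maps k H A,
     mult = (\<lambda>f g. \<lambda>h\<in>carrier H. tensor_lift k H H A (\<lambda>x y. f x \<otimes>\<^bsub>A\<^esub> g y) (\<Delta> h)),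
     one = (\<lambda>h\<in>carrier H. \<epsilon> h \<odot>\<^bsub>A\<^esub> \<one>\<^bsub>A\<^esub>),
     zero = (\<lambda>h\<in>carrier H. \<zero>\<^bsub>A\<^esub>),
     add = (\<lambda>f g. \<lambda>h\<in>carrier H. f h \<oplus>\<^bsub>A\<^esub> g h),
     smult = (\<lambda>r f. \<lambda>h\<in>carrier H. r \<odot>\<^bsub>A\<^esub> f h)\<rparr>"

text \<open>The right action of \<open>A\<close> on \<open>M \<otimes> A\<close>: \<open>(m \<otimes> b) a = m \<otimes> b a\<close>.\<close>

definition tensor_right_mult ::
  "('k, 'z) ring_scheme \<Rightarrow> ('k, 'm, 'y) module_scheme \<Rightarrow> ('k, 'a, 'x) module_scheme \<Rightarrow>
    ('m \<times> 'a \<Rightarrow> 'k) set \<Rightarrow> 'a \<Rightarrow> ('m \<times> 'a \<Rightarrow> 'k) set"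
  where "tensor_right_mult k M A t a = tensor_map k M A M A (\<lambda>m. m) (\<lambda>b. b \<otimes>\<^bsub>A\<^esub> a) t"

text \<open>Elements of \<open>End\<^sub>A(M \<otimes> A)\<close> are extensional; no \<open>k\<close>-linearity is imposed on them, since it
  follows from \<open>A\<close>-linearity.\<close>

definition endo_algebra ::
  "('k, 'z) ring_scheme \<Rightarrow> ('k, 'm, 'y) module_scheme \<Rightarrow> ('k, 'a, 'x) module_scheme \<Rightarrow>
    ('k, ('m \<times> 'a \<Rightarrow> 'k) set \<Rightarrow> ('m \<times> 'a \<Rightarrow> 'k) set) module"
  where "endo_algebra k M A =
    (let T = tensor_module k M A in
    \<lparr>carrier = {g \<in> carrier T \<rightarrow>\<^sub>E carrier T.
       (\<forall>s\<in>carrier T. \<forall>t\<in>carrier T. g (s \<oplus>\<^bsub>T\<^esub> t) = g s \<oplus>\<^bsub>T\<^esub> g t) \<and>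
       (\<forall>t\<in>carrier T. \<forall>a\<in>carrier A.
          g (tensor_right_mult k M A t a) = tensor_right_mult k M A (g t) a)},
     mult = (\<lambda>f g. compose (carrier T) f g),
     one = (\<lambda>t\<in>carrier T. t),
     zero = (\<lambda>t\<in>carrier T. \<zero>\<^bsub>T\<^esub>),
     add = (\<lambda>f g. \<lambda>t\<in>carrier T. f t \<oplus>\<^bsub>T\<^esub> g t),
     smult = (\<lambda>r f. \<lambda>t\<in>carrier T. r \<odot>\<^bsub>T\<^esub> f t)\<rparr>)"

definition hom_operator ::
  "('k, 'h, 'y) module_scheme \<Rightarrow> ('a \<Rightarrow> 'a) \<Rightarrow> ('h \<Rightarrow> 'a) \<Rightarrow> ('h \<Rightarrow> 'a)"
  where "hom_operator H Q f = compose (carrier H) Q f"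

text \<open>\<open>id\<^sub>M \<otimes> Q\<close>, that is \<open>m \<otimes> a \<mapsto> m \<otimes> Q a\<close>.\<close>

definition tensor_operator ::
  "('k, 'z) ring_scheme \<Rightarrow> ('k, 'm, 'y) module_scheme \<Rightarrow> ('k, 'a, 'x) module_scheme \<Rightarrow>
    ('a \<Rightarrow> 'a) \<Rightarrow> ('m \<times> 'a \<Rightarrow> 'k) set \<Rightarrow> ('m \<times> 'a \<Rightarrow> 'k) set"
  where "tensor_operator k M A Q = tensor_map k M A M A (\<lambda>m. m) Q"

definition endo_operator ::
  "('k, 'z) ring_scheme \<Rightarrow> ('k, 'm, 'y) module_scheme \<Rightarrow> ('k, 'a, 'x) module_scheme \<Rightarrow> ('a \<Rightarrow> 'a) \<Rightarrow>
    (('m \<times> 'a \<Rightarrow> 'k) set \<Rightarrow> ('m \<times> 'a \<Rightarrow> 'k) set) \<Rightarrow> ('m \<times> 'a \<Rightarrow> 'k) set \<Rightarrow> ('m \<times> 'a \<Rightarrow> 'k) set"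
  where "endo_operator k M A Q g =
    tensor_lift k M A (tensor_module k M A)
      (\<lambda>m a. tensor_right_mult k M A
         (tensor_operator k M A Q (g (tensor_elem k M A m \<one>\<^bsub>A\<^esub>))) a)"

text \<open>\<open>\<phi>(f)(m \<otimes> a) = \<Sum> m\<^sub>0 \<otimes> f(h\<^sub>1) a\<close> is the image of \<open>\<delta> m\<close> under \<open>x \<otimes> h \<mapsto> x \<otimes> f(h) a\<close>.\<close>

definition comodule_rep ::
  "('k, 'z) ring_scheme \<Rightarrow> ('k, 'h, 'w) module_scheme \<Rightarrow>
    ('k, 'm, 'y) module_scheme \<Rightarrow> ('m \<Rightarrow> ('m \<times> 'h \<Rightarrow> 'k) set) \<Rightarrow> ('k, 'a, 'x) module_scheme \<Rightarrow>
    ('h \<Rightarrow> 'a) \<Rightarrow> ('m \<times> 'a \<Rightarrow> 'k) set \<Rightarrow> ('m \<times> 'a \<Rightarrow> 'k) set"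
  where "comodule_rep k H M \<delta> A f =
    tensor_lift k M A (tensor_module k M A)
      (\<lambda>m a. tensor_map k M H M A (\<lambda>x. x) (\<lambda>h. f h \<otimes>\<^bsub>A\<^esub> a) (\<delta> m))"

end

theory Submission
  imports Defs
begin

text \<open>
  Write \<open>p = id \<otimes> Q\<close> and let \<open>\<Q>\<close> be the operator on \<open>End\<^sub>A(M \<otimes> A)\<close>. A right \<open>A\<close>-linear
  endomorphism of \<open>M \<otimes> A\<close> is determined by its values on the elements \<open>m \<otimes> 1\<close>, where
  \<open>\<Q>(g)(m \<otimes> 1) = p(g(m \<otimes> 1))\<close>. The Rota-Baxter identity of \<open>Q\<close> gives
  \<open>p(s) Q(a) = p(s Q(a)) + p(p(s) a) + \<lambda> p(s a)\<close> for \<open>s\<close> in \<open>M \<otimes> A\<close>; with \<open>s = g(m \<otimes> 1)\<close> this is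
  the module identity (c) at \<open>m \<otimes> a\<close>, and (c) for \<open>\<Q>(f)\<close> applied to \<open>p(g(m \<otimes> 1))\<close> is the
  Rota-Baxter identity of \<open>\<Q>\<close> at \<open>m \<otimes> 1\<close>. Associativity of the convolution product and
  multiplicativity of \<open>\<phi>\<close> are both instances of coassociativity of the coaction tested against a
  trilinear map, a coalgebra being a comodule over itself.
\<close>

section \<open>Linear, bilinear and trilinear maps\<close>

lemma k_linearI:
  assumes "\<And>x. x \<in> carrier M \<Longrightarrow> h x \<in> carrier N"
    and "\<And>x y. \<lbrakk>x \<in> carrier M; y \<in> carrier M\<rbrakk> \<Longrightarrow> h (x \<oplus>\<^bsub>M\<^esub> y) = h x \<oplus>\<^bsub>N\<^esub> h y"
    and "\<And>r x. \<lbrakk>r \<in> carrier k; x \<in> carrier M\<rbrakk> \<Longrightarrow> h (r \<odot>\<^bsub>M\<^esub> x) = r \<odot>\<^bsub>N\<^esub> h x"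
  shows "k_linear k M N h"
  using assms by (auto simp: k_linear_def)

lemma k_linear_comp:
  assumes "k_linear k M N g" "k_linear k N P h"
  shows "k_linear k M P (\<lambda>x. h (g x))"
  using assms by (intro k_linearI) (simp_all add: k_linearD)

lemma k_linear_id: "k_linear k M M (\<lambda>x. x)"
  by (intro k_linearI) auto

text \<open>Closure of \<open>carrier M\<close> under sums and scalar multiples keeps all arguments
  where the two maps agree. Linearity thereby passes to the restricted, extensional representative
  of a map.\<close>

lemma k_linear_cong:
  assumes "module k M" "\<And>x. x \<in> carrier M \<Longrightarrow> f x = g x"
  shows "k_linear k M N f \<longleftrightarrow> k_linear k M N g"
proof -
  interpret module k M by fact
  show ?thesis unfolding k_linear_def using assms(2) by (auto simp: Pi_iff)
qed

lemma k_linear_add: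
  assumes "module k N" "k_linear k M N f" "k_linear k M N g"
  shows "k_linear k M N (\<lambda>x. f x \<oplus>\<^bsub>N\<^esub> g x)"
proof -
  interpret N: module k N by fact
  show ?thesis
    using assms(2,3) by (intro k_linearI) (simp_all add: k_linearD N.M.a_ac N.smult_r_distr)
qed

text \<open>Commutativity of \<open>k\<close> enters here: two scalars acting in succession have to
  change places.\<close>

lemma k_linear_smult:
  assumes "module k N" "r \<in> carrier k" "k_linear k M N f"
  shows "k_linear k M N (\<lambda>x. r \<odot>\<^bsub>N\<^esub> f x)"
proof -
  interpret N: module k N by fact
  show ?thesis
    using assms(2,3)
    by (intro k_linearI)
      (simp_all add: k_linearD N.smult_r_distr N.smult_assoc1[symmetric] N.R.m_comm)
qed

lemma k_linear_zero:
  assumes "module k N"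
  shows "k_linear k M N (\<lambda>x. \<zero>\<^bsub>N\<^esub>)"
proof -
  interpret N: module k N by fact
  show ?thesis by (intro k_linearI) simp_all
qed

lemma linear_maps_iff: "h \<in> linear_maps k M N \<longleftrightarrow> h \<in> extensional (carrier M) \<and> k_linear k M N h"
  by (simp add: linear_maps_def)

lemma restrict_linear_maps:
  assumes "module k M" "k_linear k M N h"
  shows "restrict h (carrier M) \<in> linear_maps k M N"
  using assms(2) by (simp add: linear_maps_iff k_linear_cong[OF assms(1), of "restrict h (carrier M)" h])

lemma k_bilinearI:
  assumes "\<And>m. m \<in> carrier M \<Longrightarrow> k_linear k N P (b m)"
    and "\<And>n. n \<in> carrier N \<Longrightarrow> k_linear k M P (\<lambda>m. b m n)"
  shows "k_bilinear k M N P b"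
  using assms by (simp add: k_bilinear_def)

lemma k_bilinearD:
  assumes "k_bilinear k M N P b"
  shows "m \<in> carrier M \<Longrightarrow> k_linear k N P (b m)"
    and "n \<in> carrier N \<Longrightarrow> k_linear k M P (\<lambda>m. b m n)"
  using assms by (simp_all add: k_bilinear_def)

lemma k_bilinear_cong:
  assumes "module k M" "module k N"
    and eq: "\<And>m n. \<lbrakk>m \<in> carrier M; n \<in> carrier N\<rbrakk> \<Longrightarrow> b m n = c m n"
    and b: "k_bilinear k M N P b"
  shows "k_bilinear k M N P c"
proof (rule k_bilinearI)
  show "k_linear k N P (c m)" if "m \<in> carrier M" for m
    using k_bilinearD(1)[OF b that] k_linear_cong[OF assms(2) eq, of "\<lambda>_. m" "\<lambda>n. n" P] that
    by simp
  show "k_linear k M P (\<lambda>m. c m n)" if "n \<in> carrier N" for n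
    using k_bilinearD(2)[OF b that] k_linear_cong[OF assms(1) eq, of "\<lambda>m. m" "\<lambda>_. n" P] that
    by simp
qed

lemma k_bilinear_swap: "k_bilinear k M N P b \<Longrightarrow> k_bilinear k N M P (\<lambda>n m. b m n)"
  by (simp add: k_bilinear_def)

lemma k_bilinear_comp:
  assumes "k_bilinear k P Q R b" "k_linear k M P f" "k_linear k N Q g"
  shows "k_bilinear k M N R (\<lambda>m n. b (f m) (g n))"
proof (rule k_bilinearI)
  show "k_linear k N R (\<lambda>n. b (f m) (g n))" if "m \<in> carrier M" for m
    using k_linear_comp[OF assms(3) k_bilinearD(1)[OF assms(1) k_linearD(1)[OF assms(2) that]]] .
  show "k_linear k M R (\<lambda>m. b (f m) (g n))" if "n \<in> carrier N" for n
    using k_linear_comp[OF assms(2) k_bilinearD(2)[OF assms(1) k_linearD(1)[OF assms(3) that]]] .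
qed

lemma k_bilinear_comp_linear:
  assumes "k_bilinear k M N P b" "k_linear k P Q h"
  shows "k_bilinear k M N Q (\<lambda>m n. h (b m n))"
  using assms by (intro k_bilinearI) (auto intro: k_linear_comp k_bilinearD)

text \<open>Applied with the counit as \<open>f\<close>; commutativity of \<open>k\<close> moves a
  scalar of the second argument past \<open>f n\<close>.\<close>

lemma (in module) k_bilinear_smult:
  assumes "k_linear R N (base_module R) f"
  shows "k_bilinear R N M M (\<lambda>n x. f n \<odot>\<^bsub>M\<^esub> x)"
  using assms
  by (intro k_bilinearI k_linearI)
    (auto simp: base_module_def k_linear_def Pi_iff smult_l_distr smult_r_distr
      smult_assoc1[symmetric] R.m_comm)

text \<open>Stated through pairs of arguments, so that fixing any one of the three yields at once a
  bilinear map that can be lifted to a tensor product.\<close>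

definition k_trilinear ::
  "('k, 'z) ring_scheme \<Rightarrow> ('k, 'm, 'y) module_scheme \<Rightarrow> ('k, 'n, 'x) module_scheme \<Rightarrow>
    ('k, 'p, 'w) module_scheme \<Rightarrow> ('k, 'q, 'v) module_scheme \<Rightarrow> ('m \<Rightarrow> 'n \<Rightarrow> 'p \<Rightarrow> 'q) \<Rightarrow> bool"
  where "k_trilinear k M N P Q F \<longleftrightarrow>
    (\<forall>m\<in>carrier M. k_bilinear k N P Q (F m)) \<and>
    (\<forall>n\<in>carrier N. k_bilinear k M P Q (\<lambda>m. F m n)) \<and>
    (\<forall>p\<in>carrier P. k_bilinear k M N Q (\<lambda>m n. F m n p))"

lemma k_trilinearD:
  assumes "k_trilinear k M N P Q F"
  shows "m \<in> carrier M \<Longrightarrow> k_bilinear k N P Q (F m)"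
    and "n \<in> carrier N \<Longrightarrow> k_bilinear k M P Q (\<lambda>m. F m n)"
    and "p \<in> carrier P \<Longrightarrow> k_bilinear k M N Q (\<lambda>m n. F m n p)"
  using assms by (simp_all add: k_trilinear_def)

lemma k_trilinearI:
  assumes "\<And>m n. \<lbrakk>m \<in> carrier M; n \<in> carrier N\<rbrakk> \<Longrightarrow> k_linear k P Q (F m n)"
    and "\<And>m p. \<lbrakk>m \<in> carrier M; p \<in> carrier P\<rbrakk> \<Longrightarrow> k_linear k N Q (\<lambda>n. F m n p)"
    and "\<And>n p. \<lbrakk>n \<in> carrier N; p \<in> carrier P\<rbrakk> \<Longrightarrow> k_linear k M Q (\<lambda>m. F m n p)"
  shows "k_trilinear k M N P Q F"
  using assms by (simp add: k_trilinear_def k_bilinear_def)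

text \<open>Lifts with a parameter are formed below over the first two arguments; rotation brings
  the other cyclically adjacent pairs into that position.\<close>

lemma k_trilinear_rotate:
  "k_trilinear k M N P Q F \<Longrightarrow> k_trilinear k P M N Q (\<lambda>p m n. F m n p)"
  by (simp add: k_trilinear_def k_bilinear_def)


section \<open>Elementary tensors and lifts\<close>

lemma tensor_relators_intros:
  assumes "m \<in> carrier M" "n \<in> carrier N"
  shows "m' \<in> carrier M \<Longrightarrow> free_gen k (m \<oplus>\<^bsub>M\<^esub> m', n) \<ominus>\<^bsub>free_module k (carrier M \<times> carrier N)\<^esub> (free_gen k (m, n) \<oplus>\<^bsub>free_module k (carrier M \<times> carrier N)\<^esub> free_gen k (m', n)) \<in> tensor_relators k M N"
    and "n' \<in> carrier N \<Longrightarrow> free_gen k (m, n \<oplus>\<^bsub>N\<^esub> n') \<ominus>\<^bsub>free_module k (carrier M \<times> carrier N)\<^esub> (free_gen k (m, n) \<oplus>\<^bsub>free_module k (carrier M \<times> carrier N)\<^esub> free_gen k (m, n')) \<in> tensor_relators k M N"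
    and "r \<in> carrier k \<Longrightarrow> free_gen k (r \<odot>\<^bsub>M\<^esub> m, n) \<ominus>\<^bsub>free_module k (carrier M \<times> carrier N)\<^esub> (r \<odot>\<^bsub>free_module k (carrier M \<times> carrier N)\<^esub> free_gen k (m, n)) \<in> tensor_relators k M N"
    and "r \<in> carrier k \<Longrightarrow> free_gen k (m, r \<odot>\<^bsub>N\<^esub> n) \<ominus>\<^bsub>free_module k (carrier M \<times> carrier N)\<^esub> (r \<odot>\<^bsub>free_module k (carrier M \<times> carrier N)\<^esub> free_gen k (m, n)) \<in> tensor_relators k M N"
  using assms unfolding tensor_relators_def Let_def by blast+

context
  fixes k :: "('k, 'z) ring_scheme" and M :: "('k, 'm, 'y) module_scheme"
    and N :: "('k, 'n, 'x) module_scheme"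
  assumes M: "module k M" and N: "module k N"
begin

interpretation M: module k M by (rule M)
interpretation N: module k N by (rule N)
interpretation T: module k "tensor_module k M N" by (rule tensor_module_module[OF M N])

interpretation F: module k "free_module k (carrier M \<times> carrier N)" by (rule free_module_module) (rule M.R.cring_axioms)

lemma tensor_kernel_submodule: "submodule (tensor_kernel k M N) k (free_module k (carrier M \<times> carrier N))"
  unfolding tensor_kernel_def
  by (intro submodule_span_submodule F.module_axioms tensor_relators_closed M N)

lemma tensor_relator_in_kernel: "x \<in> tensor_relators k M N \<Longrightarrow> x \<in> tensor_kernel k M N"
  unfolding tensor_kernel_def
  using submodule_span_submodule(2)[OF F.module_axioms tensor_relators_closed[OF M N]] by blast

lemma pair_gen_closed:
  "\<lbrakk>m \<in> carrier M; n \<in> carrier N\<rbrakk> \<Longrightarrow> free_gen k (m, n) \<in> carrier (free_module k (carrier M \<times> carrier N))"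
  by (intro free_gen_closed M.R.cring_axioms) auto

lemma tensor_elem_closed:
  "\<lbrakk>m \<in> carrier M; n \<in> carrier N\<rbrakk> \<Longrightarrow> tensor_elem k M N m n \<in> carrier (tensor_module k M N)"
  using pair_gen_closed
  by (auto simp: tensor_elem_def tensor_module_def
      quotient_carrier[OF F.module_axioms tensor_kernel_submodule])

text \<open>The two sides of each law are cosets of elements whose difference is a relator, hence
  lies in the kernel.\<close>

lemma tensor_elem_bilinear: "k_bilinear k M N (tensor_module k M N) (tensor_elem k M N)"
proof -
  note FW = F.module_axioms tensor_kernel_submodule
  note eq = quotient_eq_iff[OF FW, THEN iffD2, OF _ _ tensor_relator_in_kernel]
  note qa = quotient_add[OF FW] and qs = quotient_smult[OF FW]
  show ?thesis
  proof (intro k_bilinearI k_linearI)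
    fix m n n' assume "m \<in> carrier M" "n \<in> carrier N" "n' \<in> carrier N"
    then show "tensor_elem k M N m (n \<oplus>\<^bsub>N\<^esub> n') = tensor_elem k M N m n \<oplus>\<^bsub>tensor_module k M N\<^esub> tensor_elem k M N m n'"
      unfolding tensor_elem_def tensor_module_def
      by (simp only: qa pair_gen_closed, intro eq tensor_relators_intros)
        (simp_all del: free_module_simps add: pair_gen_closed)
  next
    fix m m' n assume "m \<in> carrier M" "m' \<in> carrier M" "n \<in> carrier N"
    then show "tensor_elem k M N (m \<oplus>\<^bsub>M\<^esub> m') n = tensor_elem k M N m n \<oplus>\<^bsub>tensor_module k M N\<^esub> tensor_elem k M N m' n"
      unfolding tensor_elem_def tensor_module_def
      by (simp only: qa pair_gen_closed, intro eq tensor_relators_intros)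
        (simp_all del: free_module_simps add: pair_gen_closed)
  next
    fix r m n assume "r \<in> carrier k" "m \<in> carrier M" "n \<in> carrier N"
    then show "tensor_elem k M N (r \<odot>\<^bsub>M\<^esub> m) n = r \<odot>\<^bsub>tensor_module k M N\<^esub> tensor_elem k M N m n"
      and "tensor_elem k M N m (r \<odot>\<^bsub>N\<^esub> n) = r \<odot>\<^bsub>tensor_module k M N\<^esub> tensor_elem k M N m n"
      unfolding tensor_elem_def tensor_module_def
      by (simp only: qs pair_gen_closed, intro eq tensor_relators_intros,
          simp_all del: free_module_simps add: pair_gen_closed)+
  qed (auto simp: tensor_elem_closed)
qed

lemma tensor_elem_simps:
  assumes "m \<in> carrier M" "n \<in> carrier N"
  shows "m' \<in> carrier M \<Longrightarrow>
      tensor_elem k M N (m \<oplus>\<^bsub>M\<^esub> m') n = tensor_elem k M N m n \<oplus>\<^bsub>tensor_module k M N\<^esub> tensor_elem k M N m' n"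
    and "n' \<in> carrier N \<Longrightarrow>
      tensor_elem k M N m (n \<oplus>\<^bsub>N\<^esub> n') = tensor_elem k M N m n \<oplus>\<^bsub>tensor_module k M N\<^esub> tensor_elem k M N m n'"
    and "r \<in> carrier k \<Longrightarrow> tensor_elem k M N (r \<odot>\<^bsub>M\<^esub> m) n = r \<odot>\<^bsub>tensor_module k M N\<^esub> tensor_elem k M N m n"
    and "r \<in> carrier k \<Longrightarrow> tensor_elem k M N m (r \<odot>\<^bsub>N\<^esub> n) = r \<odot>\<^bsub>tensor_module k M N\<^esub> tensor_elem k M N m n"
  using k_bilinearD[OF tensor_elem_bilinear] assms by (simp_all add: k_linear_def)

text \<open>An element of the free module is a finite combination of generators. A coefficient is
  absorbed into the left factor, \<open>r (m \<otimes> n) = (r m) \<otimes> n\<close>, and zero is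
  \<open>0 \<otimes> 0\<close>, so sums are the only case besides elementary tensors.\<close>

lemma tensor_induct [consumes 1, case_names elem add]:
  assumes t: "t \<in> carrier (tensor_module k M N)"
    and elem: "\<And>m n. \<lbrakk>m \<in> carrier M; n \<in> carrier N\<rbrakk> \<Longrightarrow> Pr (tensor_elem k M N m n)"
    and add: "\<And>s t. \<lbrakk>s \<in> carrier (tensor_module k M N); t \<in> carrier (tensor_module k M N); Pr s; Pr t\<rbrakk> \<Longrightarrow> Pr (s \<oplus>\<^bsub>tensor_module k M N\<^esub> t)"
  shows "Pr t"
proof -
  let ?F = "free_module k (carrier M \<times> carrier N)" and ?W = "tensor_kernel k M N"
  note FW = F.module_axioms tensor_kernel_submodule
  have tc: "?W +>\<^bsub>?F\<^esub> f \<in> carrier (tensor_module k M N)" if "f \<in> carrier ?F" for f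
    using that by (auto simp: tensor_module_def quotient_carrier[OF FW])
  have "Pr (?W +>\<^bsub>?F\<^esub> f)" if "f \<in> carrier ?F" for f
    using M.R.cring_axioms that
  proof (induction rule: free_module_induct)
    case zero
    have "tensor_elem k M N \<zero>\<^bsub>M\<^esub> \<zero>\<^bsub>N\<^esub> = \<zero>\<^bsub>tensor_module k M N\<^esub>"
      using k_linear_zero_minus(1)[OF M T.module_axioms
          k_bilinearD(2)[OF tensor_elem_bilinear N.M.zero_closed]] .
    also have "\<dots> = ?W +>\<^bsub>?F\<^esub> (\<lambda>x. \<zero>\<^bsub>k\<^esub>)"
      unfolding tensor_module_def by (simp add: quotient_zero[OF FW])
    finally show ?case using elem[of "\<zero>\<^bsub>M\<^esub>" "\<zero>\<^bsub>N\<^esub>"] by simp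
  next
    case (step r x f)
    obtain m n where x: "x = (m, n)" "m \<in> carrier M" "n \<in> carrier N" using step(2) by auto
    note ec = pair_gen_closed[OF x(2,3)]
    note rc = F.smult_closed[OF step(1) ec]
    have "?W +>\<^bsub>?F\<^esub> (\<lambda>y. r \<otimes>\<^bsub>k\<^esub> free_gen k x y \<oplus>\<^bsub>k\<^esub> f y) =
        r \<odot>\<^bsub>tensor_module k M N\<^esub> tensor_elem k M N m n \<oplus>\<^bsub>tensor_module k M N\<^esub> (?W +>\<^bsub>?F\<^esub> f)"
      unfolding tensor_module_def tensor_elem_def x(1)
      by (simp only: quotient_add[OF FW rc step(3)] quotient_smult[OF FW step(1) ec])
        (simp only: free_module_simps)
    also have "\<dots> = tensor_elem k M N (r \<odot>\<^bsub>M\<^esub> m) n \<oplus>\<^bsub>tensor_module k M N\<^esub> (?W +>\<^bsub>?F\<^esub> f)"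
      using step(1) x by (simp add: tensor_elem_simps)
    finally show ?case
      using step x by (simp add: add elem tensor_elem_closed tc)
  qed
  with t show ?thesis by (auto simp: tensor_module_def quotient_carrier[OF FW])
qed

text \<open>The universal property makes the definite description in \<open>tensor_lift\<close>
  denote an actual map.\<close>

lemma tensor_lift_props:
  assumes "module k P" "k_bilinear k M N P b"
  shows "tensor_lift k M N P b \<in> linear_maps k (tensor_module k M N) P"
    and "\<lbrakk>m \<in> carrier M; n \<in> carrier N\<rbrakk> \<Longrightarrow> tensor_lift k M N P b (tensor_elem k M N m n) = b m n"
  using theI'[OF tensor_universal[OF M N assms]] unfolding tensor_lift_def by blast+

lemma tensor_lift_linear:
  "\<lbrakk>module k P; k_bilinear k M N P b\<rbrakk> \<Longrightarrow> k_linear k (tensor_module k M N) P (tensor_lift k M N P b)"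
  by (drule (1) tensor_lift_props(1)) (simp add: linear_maps_iff)

lemma tensor_map_ext:
  assumes "k_linear k (tensor_module k M N) P f" "k_linear k (tensor_module k M N) P g"
    and "\<And>m n. \<lbrakk>m \<in> carrier M; n \<in> carrier N\<rbrakk> \<Longrightarrow> f (tensor_elem k M N m n) = g (tensor_elem k M N m n)"
    and "t \<in> carrier (tensor_module k M N)"
  shows "f t = g t"
  using assms(4) by (induction rule: tensor_induct) (simp_all add: assms(3) k_linearD(2)[OF assms(1)] k_linearD(2)[OF assms(2)])

text \<open>The main device for Sweedler sums: a lift is evaluated at an arbitrary tensor, such as
  \<open>\<delta> m\<close>, by exhibiting a linear map with the right values on elementary tensors.
  Bilinearity of \<open>b\<close> is inherited from \<open>h\<close> and need not be checked
  separately.\<close>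

lemma tensor_lift_unique:
  assumes P: "module k P" and h: "k_linear k (tensor_module k M N) P h"
    and b: "\<And>m n. \<lbrakk>m \<in> carrier M; n \<in> carrier N\<rbrakk> \<Longrightarrow> h (tensor_elem k M N m n) = b m n"
    and t: "t \<in> carrier (tensor_module k M N)"
  shows "tensor_lift k M N P b t = h t"
proof -
  have "k_bilinear k M N P b"
    by (rule k_bilinear_cong[OF M N b k_bilinear_comp_linear[OF tensor_elem_bilinear h]])
  from tensor_map_ext[OF tensor_lift_linear[OF P this] h _ t] tensor_lift_props(2)[OF P this] b
  show ?thesis by simp
qed

text \<open>Lifting two arguments leaves the third as a parameter. Linearity in this parameter
  follows from uniqueness: the sum of the lifts at \<open>p\<close> and \<open>p'\<close> is linear
  and has the values prescribed for the lift at the sum, and likewise for scalar multiples.\<close>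

lemma tensor_lift_bilinear:
  assumes P: "module k P" and Q: "module k Q" and b: "k_trilinear k M N P Q b"
  shows "k_bilinear k (tensor_module k M N) P Q (\<lambda>t p. tensor_lift k M N Q (\<lambda>m n. b m n p) t)"
proof (intro k_bilinearI)
  interpret Q: module k Q by fact
  interpret P: module k P by fact
  note lin = tensor_lift_linear[OF Q k_trilinearD(3)[OF b]]
  fix t assume t: "t \<in> carrier (tensor_module k M N)"
  have lp: "k_linear k P Q (b m n)" if "m \<in> carrier M" "n \<in> carrier N" for m n
    using k_bilinearD(1)[OF k_trilinearD(1)[OF b that(1)] that(2)] .
  note lp = k_linearD[OF lp]
  show "k_linear k P Q (\<lambda>p. tensor_lift k M N Q (\<lambda>m n. b m n p) t)"
  proof (rule k_linearI)
    show "tensor_lift k M N Q (\<lambda>m n. b m n p) t \<in> carrier Q" if "p \<in> carrier P" for p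
      using lin[OF that] t by (rule k_linearD(1))
    show "tensor_lift k M N Q (\<lambda>m n. b m n (p \<oplus>\<^bsub>P\<^esub> p')) t =
        tensor_lift k M N Q (\<lambda>m n. b m n p) t \<oplus>\<^bsub>Q\<^esub> tensor_lift k M N Q (\<lambda>m n. b m n p') t"
      if "p \<in> carrier P" "p' \<in> carrier P" for p p'
      using t that
      by (intro tensor_lift_unique Q k_linear_add lin)
        (simp_all add: lp tensor_lift_props(2)[OF Q k_trilinearD(3)[OF b]])
    show "tensor_lift k M N Q (\<lambda>m n. b m n (r \<odot>\<^bsub>P\<^esub> p)) t =
        r \<odot>\<^bsub>Q\<^esub> tensor_lift k M N Q (\<lambda>m n. b m n p) t"
      if "r \<in> carrier k" "p \<in> carrier P" for r p
      using t that
      by (intro tensor_lift_unique Q k_linear_smult lin)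
        (simp_all add: lp tensor_lift_props(2)[OF Q k_trilinearD(3)[OF b]])
  qed
next
  fix p assume "p \<in> carrier P"
  then show "k_linear k (tensor_module k M N) Q (\<lambda>t. tensor_lift k M N Q (\<lambda>m n. b m n p) t)"
    by (intro tensor_lift_linear Q k_trilinearD[OF b])
qed

end

section \<open>Functoriality of the tensor product and the associator\<close>

lemma tensor_map_props:
  assumes M: "module k M" and N: "module k N" and P: "module k P" and Q: "module k Q"
    and f: "k_linear k M P f" and g: "k_linear k N Q g"
  shows "tensor_map k M N P Q f g \<in> linear_maps k (tensor_module k M N) (tensor_module k P Q)"
    and "\<lbrakk>m \<in> carrier M; n \<in> carrier N\<rbrakk> \<Longrightarrow>
      tensor_map k M N P Q f g (tensor_elem k M N m n) = tensor_elem k P Q (f m) (g n)"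
  using tensor_lift_props[OF M N tensor_module_module[OF P Q]
      k_bilinear_comp[OF tensor_elem_bilinear[OF P Q] f g]]
  unfolding tensor_map_def by simp_all

lemma tensor_map_linear:
  assumes "module k M" "module k N" "module k P" "module k Q" "k_linear k M P f" "k_linear k N Q g"
  shows "k_linear k (tensor_module k M N) (tensor_module k P Q) (tensor_map k M N P Q f g)"
  using tensor_map_props(1)[OF assms] by (simp add: linear_maps_iff)

text \<open>The associator is a nested lift, hence \<open>tensor_lift_bilinear\<close> for the
  trilinear map sending \<open>m\<close>, \<open>n\<close>, \<open>p\<close> to
  \<open>m \<otimes> (n \<otimes> p)\<close>. The first factor \<open>t\<close> stays arbitrary
  because it will be a coaction value \<open>\<delta> x\<close>, which need not be
  elementary.\<close>

lemma tensor_assoc_props: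
  assumes M: "module k M" and N: "module k N" and P: "module k P"
  defines "S \<equiv> tensor_module k M (tensor_module k N P)"
  shows "k_linear k (tensor_module k (tensor_module k M N) P) S (tensor_assoc k M N P)"
    and "\<lbrakk>t \<in> carrier (tensor_module k M N); p \<in> carrier P\<rbrakk> \<Longrightarrow>
      tensor_assoc k M N P (tensor_elem k (tensor_module k M N) P t p) =
      tensor_lift k M N S (\<lambda>m n. tensor_elem k M (tensor_module k N P) m (tensor_elem k N P n p)) t"
proof -
  note MN = tensor_module_module[OF M N] and NP = tensor_module_module[OF N P]
  note S = tensor_module_module[OF M NP, folded S_def]
  have "k_trilinear k M N P S
      (\<lambda>m n p. tensor_elem k M (tensor_module k N P) m (tensor_elem k N P n p))"
    unfolding S_def
    by (intro k_trilinearI k_linearI)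
      (simp_all add: tensor_elem_simps M N P NP tensor_elem_closed)
  note b = tensor_lift_bilinear[OF M N P S this]
  show "k_linear k (tensor_module k (tensor_module k M N) P) S (tensor_assoc k M N P)"
    using tensor_lift_linear[OF MN P S b] by (simp add: tensor_assoc_def Let_def S_def)
  show "tensor_assoc k M N P (tensor_elem k (tensor_module k M N) P t p) =
      tensor_lift k M N S (\<lambda>m n. tensor_elem k M (tensor_module k N P) m (tensor_elem k N P n p)) t"
    if "t \<in> carrier (tensor_module k M N)" "p \<in> carrier P"
    using tensor_lift_props(2)[OF MN P S b that] by (simp add: tensor_assoc_def Let_def S_def)
qed

text \<open>The description defining a lift sees \<open>b\<close> only on the two carriers. As a
  congruence rule this permits rewriting the summand of a Sweedler sum.\<close>

lemma tensor_lift_cong: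
  assumes "\<And>m n. \<lbrakk>m \<in> carrier M; n \<in> carrier N\<rbrakk> \<Longrightarrow> b m n = c m n"
  shows "tensor_lift k M N P b = tensor_lift k M N P c"
  using assms unfolding tensor_lift_def by simp

text \<open>Common to \<open>Hom_k(H,A)\<close> and \<open>End_A(M \<otimes> A)\<close>: both
  consist of extensional functions with pointwise operations, so the axioms are inherited from the
  target and only closure remains to be shown.\<close>

lemma pointwise_module:
  assumes N: "module k N"
    and funcs: "carrier L \<subseteq> X \<rightarrow>\<^sub>E carrier N"
    and add: "\<And>f g. f \<oplus>\<^bsub>L\<^esub> g = (\<lambda>x\<in>X. f x \<oplus>\<^bsub>N\<^esub> g x)"
    and zero: "\<zero>\<^bsub>L\<^esub> = (\<lambda>x\<in>X. \<zero>\<^bsub>N\<^esub>)"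
    and smult: "\<And>r f. r \<odot>\<^bsub>L\<^esub> f = (\<lambda>x\<in>X. r \<odot>\<^bsub>N\<^esub> f x)"
    and zero_closed: "\<zero>\<^bsub>L\<^esub> \<in> carrier L"
    and add_closed: "\<And>f g. \<lbrakk>f \<in> carrier L; g \<in> carrier L\<rbrakk> \<Longrightarrow> f \<oplus>\<^bsub>L\<^esub> g \<in> carrier L"
    and smult_closed: "\<And>r f. \<lbrakk>r \<in> carrier k; f \<in> carrier L\<rbrakk> \<Longrightarrow> r \<odot>\<^bsub>L\<^esub> f \<in> carrier L"
  shows "module k L"
proof -
  interpret N: module k N by fact
  have c: "f x \<in> carrier N" if "f \<in> carrier L" "x \<in> X" for f x
    using funcs that by auto
  have e: "(\<lambda>x\<in>X. f x) = f" if "f \<in> carrier L" for f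
    using funcs that by (auto simp: PiE_def extensional_restrict)
  show ?thesis
  proof (rule moduleI[OF N.R.cring_axioms])
    show "abelian_group L"
    proof (rule abelian_groupI)
      fix f assume f: "f \<in> carrier L"
      \<comment> \<open>The scalar \<open>-1\<close> provides negatives, so closure under scalar
        multiples covers them.\<close>
      have "(\<ominus>\<^bsub>k\<^esub> \<one>\<^bsub>k\<^esub>) \<odot>\<^bsub>L\<^esub> f \<oplus>\<^bsub>L\<^esub> f = \<zero>\<^bsub>L\<^esub>"
        using f by (auto simp: add zero smult c N.smult_l_minus N.l_neg intro!: restrict_ext)
      then show "\<exists>g\<in>carrier L. g \<oplus>\<^bsub>L\<^esub> f = \<zero>\<^bsub>L\<^esub>"
        using f smult_closed by blast
    next
      fix f assume f: "f \<in> carrier L"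
      have "\<zero>\<^bsub>L\<^esub> \<oplus>\<^bsub>L\<^esub> f = (\<lambda>x\<in>X. f x)"
        using f by (auto simp: add zero c intro!: restrict_ext)
      then show "\<zero>\<^bsub>L\<^esub> \<oplus>\<^bsub>L\<^esub> f = f" using e[OF f] by simp
    qed (auto simp: add_closed zero_closed, auto simp: add c N.M.a_ac intro!: restrict_ext)
  next
    fix f assume f: "f \<in> carrier L"
    have "\<one>\<^bsub>k\<^esub> \<odot>\<^bsub>L\<^esub> f = (\<lambda>x\<in>X. f x)"
      using f by (auto simp: smult c intro!: restrict_ext)
    then show "\<one>\<^bsub>k\<^esub> \<odot>\<^bsub>L\<^esub> f = f" using e[OF f] by simp
  qed (auto simp: smult_closed, auto simp: add smult c N.smult_l_distr N.smult_r_distr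
        N.smult_assoc1 intro!: restrict_ext)
qed


section \<open>The convolution algebra\<close>

lemma (in k_algebra) mult_bilinear: "k_bilinear k A A A (\<otimes>)"
  by (intro k_bilinearI k_linearI)
    (simp_all add: l_distr r_distr smult_mult_left smult_mult_right)

text \<open>Makes statements about coactions available for \<open>\<Delta>\<close> itself.\<close>

lemma (in coalgebra) right_comodule_self: "right_comodule k H \<Delta> \<epsilon> H \<Delta>"
  by (intro right_comodule.intro right_comodule_axioms.intro coalgebra_axioms module_axioms
      comult_linear coassoc)

text \<open>In Sweedler notation: the sum of \<open>F(m_0, h_1, h_2)\<close> does not depend on
  whether the coaction is iterated or followed by \<open>\<Delta>\<close>. A linear map
  \<open>G\<close> induced by \<open>F\<close> on \<open>M \<otimes> (H \<otimes> H)\<close> is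
  applied to both sides of the comodule axiom.\<close>

lemma (in right_comodule) coassoc_lift:
  assumes P: "module k P" and F: "k_trilinear k M H H P F" and m: "m \<in> carrier M"
  shows "tensor_lift k M H P (\<lambda>x c. tensor_lift k M H P (\<lambda>a b. F a b c) (\<delta> x)) (\<delta> m) =
    tensor_lift k M H P (\<lambda>a v. tensor_lift k H H P (F a) (\<Delta> v)) (\<delta> m)"
proof -
  note Mm = M.module_axioms and Hm = module_axioms
  note HH = tensor_module_module[OF Hm Hm] and MH = tensor_module_module[OF Mm Hm]
  define G where "G = tensor_lift k M (tensor_module k H H) P (\<lambda>a. tensor_lift k H H P (F a))"
  \<comment> \<open>Two rotations put the arguments in the order \<open>b\<close>, \<open>c\<close>,
    \<open>a\<close>, so that the lift runs over the two factors in \<open>H\<close> with the one in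
    \<open>M\<close> as parameter.\<close>
  have b: "k_bilinear k M (tensor_module k H H) P (\<lambda>a. tensor_lift k H H P (F a))"
    using k_bilinear_swap[OF tensor_lift_bilinear[OF Hm Hm Mm P
          k_trilinear_rotate[OF k_trilinear_rotate[OF F]]]] .
  have G: "k_linear k (tensor_module k M (tensor_module k H H)) P G"
    unfolding G_def by (rule tensor_lift_linear[OF Mm HH P b])
  have Ge: "G (tensor_elem k M (tensor_module k H H) a v) = tensor_lift k H H P (F a) v"
    if "a \<in> carrier M" "v \<in> carrier (tensor_module k H H)" for a v
    unfolding G_def using tensor_lift_props(2)[OF Mm HH P b that] .
  have dm: "\<delta> x \<in> carrier (tensor_module k M H)" if "x \<in> carrier M" for x
    using k_linearD(1)[OF coaction_linear that] .
  have dh: "\<Delta> x \<in> carrier (tensor_module k H H)" if "x \<in> carrier H" for x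
    using k_linearD(1)[OF comult_linear that] .
  note assoc = tensor_assoc_props[OF Mm Hm Hm]
  \<comment> \<open>The iterated coaction is \<open>G\<close> after the associator and
    \<open>\<delta> \<otimes> id\<close>; by uniqueness it suffices to compare values at
    \<open>x \<otimes> c\<close>.\<close>
  have "tensor_lift k M H P (\<lambda>x c. tensor_lift k M H P (\<lambda>a b. F a b c) (\<delta> x)) (\<delta> m) =
      G (tensor_assoc k M H H (tensor_map k M H (tensor_module k M H) H \<delta> (\<lambda>x. x) (\<delta> m)))"
  proof (rule tensor_lift_unique[OF Mm Hm P _ _ dm[OF m]])
    note tm = Mm Hm MH Hm coaction_linear k_linear_id
    show "k_linear k (tensor_module k M H) P
        (\<lambda>t. G (tensor_assoc k M H H (tensor_map k M H (tensor_module k M H) H \<delta> (\<lambda>x. x) t)))"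
      by (intro k_linear_comp[OF k_linear_comp[OF tensor_map_linear[OF tm] assoc(1)] G])
    fix x c assume x: "x \<in> carrier M" and c: "c \<in> carrier H"
    let ?S = "tensor_module k M (tensor_module k H H)"
    have "k_linear k H (tensor_module k H H) (\<lambda>b. tensor_elem k H H b c)"
      by (rule k_bilinearD(2)[OF tensor_elem_bilinear[OF Hm Hm] c])
    from k_bilinear_comp[OF tensor_elem_bilinear[OF Mm HH] k_linear_id this]
    have e: "k_bilinear k M H ?S
        (\<lambda>a b. tensor_elem k M (tensor_module k H H) a (tensor_elem k H H b c))" .
    \<comment> \<open>At \<open>\<delta> x \<otimes> c\<close> the associator is still a lift
      evaluated at \<open>\<delta> x\<close>, so uniqueness is invoked a second time, now for the
      inner sum.\<close>
    have "tensor_lift k M H P (\<lambda>a b. F a b c) (\<delta> x) = G (tensor_lift k M H ?S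
        (\<lambda>a b. tensor_elem k M (tensor_module k H H) a (tensor_elem k H H b c)) (\<delta> x))"
    proof (rule tensor_lift_unique[OF Mm Hm P k_linear_comp[OF tensor_lift_linear[OF Mm Hm _ e] G]
            _ dm[OF x]])
      show mS: "module k ?S" by (rule tensor_module_module[OF Mm HH])
      fix a b assume "a \<in> carrier M" "b \<in> carrier H"
      then show "G (tensor_lift k M H ?S
          (\<lambda>a b. tensor_elem k M (tensor_module k H H) a (tensor_elem k H H b c))
          (tensor_elem k M H a b)) = F a b c"
        using c by (simp add: tensor_lift_props(2)[OF Mm Hm mS e] Ge tensor_elem_closed[OF Hm Hm]
            tensor_lift_props(2)[OF Hm Hm P k_trilinearD(1)[OF F]])
    qed
    then show "G (tensor_assoc k M H H (tensor_map k M H (tensor_module k M H) H \<delta> (\<lambda>x. x)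
        (tensor_elem k M H x c))) = tensor_lift k M H P (\<lambda>a b. F a b c) (\<delta> x)"
      using x c by (simp add: tensor_map_props(2)[OF tm] assoc(2) dm)
  qed
  also have "\<dots> = G (tensor_map k M H M (tensor_module k H H) (\<lambda>x. x) \<Delta> (\<delta> m))"
    by (simp add: coaction_coassoc m)
  also have "\<dots> = tensor_lift k M H P (\<lambda>a v. tensor_lift k H H P (F a) (\<Delta> v)) (\<delta> m)"
  proof (rule tensor_lift_unique[OF Mm Hm P _ _ dm[OF m], symmetric])
    note tm = Mm Hm Mm HH k_linear_id comult_linear
    show "k_linear k (tensor_module k M H) P
        (\<lambda>t. G (tensor_map k M H M (tensor_module k H H) (\<lambda>x. x) \<Delta> t))"
      by (intro k_linear_comp[OF tensor_map_linear[OF tm] G])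
    show "G (tensor_map k M H M (tensor_module k H H) (\<lambda>x. x) \<Delta> (tensor_elem k M H a v)) =
        tensor_lift k H H P (F a) (\<Delta> v)" if "a \<in> carrier M" "v \<in> carrier H" for a v
      using that by (simp add: tensor_map_props(2)[OF tm] Ge dh)
  qed
  finally show ?thesis .
qed

section \<open>Algebra structure on \<open>Hom_k(H,A)\<close>\<close>

locale convolution = H: coalgebra k H \<Delta> \<epsilon> + A: k_algebra k A
  for k :: "('k, 'z) ring_scheme" and H :: "('k, 'h, 'y) module_scheme" and \<Delta> \<epsilon>
    and A :: "('k, 'a, 'x) module_scheme"
begin

abbreviation "C \<equiv> convolution_algebra k H \<Delta> \<epsilon> A"

lemma convolution_simps:
  "carrier C = linear_maps k H A"
  "f \<otimes>\<^bsub>C\<^esub> g = (\<lambda>h\<in>carrier H. tensor_lift k H H A (\<lambda>x y. f x \<otimes>\<^bsub>A\<^esub> g y) (\<Delta> h))"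
  "\<one>\<^bsub>C\<^esub> = (\<lambda>h\<in>carrier H. \<epsilon> h \<odot>\<^bsub>A\<^esub> \<one>\<^bsub>A\<^esub>)"
  "\<zero>\<^bsub>C\<^esub> = (\<lambda>h\<in>carrier H. \<zero>\<^bsub>A\<^esub>)"
  "f \<oplus>\<^bsub>C\<^esub> g = (\<lambda>h\<in>carrier H. f h \<oplus>\<^bsub>A\<^esub> g h)"
  "r \<odot>\<^bsub>C\<^esub> f = (\<lambda>h\<in>carrier H. r \<odot>\<^bsub>A\<^esub> f h)"
  by (simp_all add: convolution_algebra_def)

lemma convolution_apply:
  assumes "h \<in> carrier H"
  shows "(f \<otimes>\<^bsub>C\<^esub> g) h = tensor_lift k H H A (\<lambda>x y. f x \<otimes>\<^bsub>A\<^esub> g y) (\<Delta> h)"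
    and "\<one>\<^bsub>C\<^esub> h = \<epsilon> h \<odot>\<^bsub>A\<^esub> \<one>\<^bsub>A\<^esub>"
    and "(f \<oplus>\<^bsub>C\<^esub> g) h = f h \<oplus>\<^bsub>A\<^esub> g h"
    and "(r \<odot>\<^bsub>C\<^esub> f) h = r \<odot>\<^bsub>A\<^esub> f h"
  using assms by (simp_all add: convolution_simps)

lemma carrierD:
  assumes "f \<in> carrier C"
  shows "k_linear k H A f" "f \<in> extensional (carrier H)" "x \<in> carrier H \<Longrightarrow> f x \<in> carrier A"
  using assms k_linearD(1)[of k H A f] by (simp_all add: convolution_simps linear_maps_iff)

lemma comult_closed: "x \<in> carrier H \<Longrightarrow> \<Delta> x \<in> carrier (tensor_module k H H)"
  by (rule k_linearD(1)[OF H.comult_linear])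

lemma mult_map_bilinear:
  "\<lbrakk>f \<in> carrier C; g \<in> carrier C\<rbrakk> \<Longrightarrow> k_bilinear k H H A (\<lambda>x y. f x \<otimes>\<^bsub>A\<^esub> g y)"
  by (intro k_bilinear_comp[OF A.mult_bilinear] carrierD)

lemmas mult_lift =
  tensor_lift_linear[OF H.module_axioms H.module_axioms A.module_axioms mult_map_bilinear]
  tensor_lift_props(2)[OF H.module_axioms H.module_axioms A.module_axioms mult_map_bilinear]

text \<open>Replaces a convolution product by any linear function of \<open>\<Delta> x\<close> with
  the same values on elementary tensors; most algebra laws below become laws of \<open>A\<close> in
  this way.\<close>

lemma mult_eqI:
  assumes "k_linear k (tensor_module k H H) A u"
    and "\<And>x y. \<lbrakk>x \<in> carrier H; y \<in> carrier H\<rbrakk> \<Longrightarrow> u (tensor_elem k H H x y) = f x \<otimes>\<^bsub>A\<^esub> g y"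
    and "x \<in> carrier H"
  shows "(f \<otimes>\<^bsub>C\<^esub> g) x = u (\<Delta> x)"
  using assms
  by (simp add: convolution_simps(2) comult_closed
      tensor_lift_unique[OF H.module_axioms H.module_axioms A.module_axioms])

lemma mult_closed: "\<lbrakk>f \<in> carrier C; g \<in> carrier C\<rbrakk> \<Longrightarrow> f \<otimes>\<^bsub>C\<^esub> g \<in> carrier C"
  unfolding convolution_simps(1,2)
  by (intro restrict_linear_maps H.module_axioms k_linear_comp[OF H.comult_linear] mult_lift)
    (simp_all add: convolution_simps)

lemma one_closed: "\<one>\<^bsub>C\<^esub> \<in> carrier C"
  unfolding convolution_simps(1,3)
  by (intro restrict_linear_maps H.module_axioms k_bilinearD(2)[OF A.k_bilinear_smult]
      H.counit_linear A.one_closed)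

lemma convolution_module: "module k C"
proof (rule pointwise_module[OF A.module_axioms])
  show "carrier C \<subseteq> carrier H \<rightarrow>\<^sub>E carrier A"
    using carrierD by (auto simp: PiE_def)
  show "\<zero>\<^bsub>C\<^esub> \<in> carrier C"
    unfolding convolution_simps(1,4)
    by (intro restrict_linear_maps H.module_axioms k_linear_zero A.module_axioms)
  show "f \<oplus>\<^bsub>C\<^esub> g \<in> carrier C" if "f \<in> carrier C" "g \<in> carrier C" for f g
    using that unfolding convolution_simps(1,5)
    by (intro restrict_linear_maps H.module_axioms k_linear_add A.module_axioms)
      (simp_all add: linear_maps_iff)
  show "r \<odot>\<^bsub>C\<^esub> f \<in> carrier C" if "r \<in> carrier k" "f \<in> carrier C" for r f
    using that unfolding convolution_simps(1,6)
    by (intro restrict_linear_maps H.module_axioms k_linear_smult A.module_axioms)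
      (simp_all add: linear_maps_iff)
qed (simp_all add: convolution_simps)

interpretation C: module k C by (rule convolution_module)

text \<open>Both bracketings are sums of \<open>f(a) g(b) h(c)\<close> over an iterated
  comultiplication, and \<open>coassoc_lift\<close> for \<open>H\<close> as a comodule over itself
  identifies them.\<close>

lemma mult_assoc:
  assumes f: "f \<in> carrier C" and g: "g \<in> carrier C" and h: "h \<in> carrier C"
  shows "(f \<otimes>\<^bsub>C\<^esub> g) \<otimes>\<^bsub>C\<^esub> h = f \<otimes>\<^bsub>C\<^esub> (g \<otimes>\<^bsub>C\<^esub> h)"
proof (rule extensionalityI[of _ "carrier H"])
  fix x assume x: "x \<in> carrier H"
  note Hm = H.module_axioms and Am = A.module_axioms
  interpret right_comodule k H \<Delta> \<epsilon> H \<Delta> by (rule H.right_comodule_self)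
  note fgh = f[THEN carrierD(3)] g[THEN carrierD(3)] h[THEN carrierD(3)]
  \<comment> \<open>Right multiplication by the fixed element \<open>h c\<close> is linear, hence
    passes through the lift.\<close>
  have lift_r: "tensor_lift k H H A (\<lambda>a b. f a \<otimes>\<^bsub>A\<^esub> g b \<otimes>\<^bsub>A\<^esub> h c) (\<Delta> u) = (f \<otimes>\<^bsub>C\<^esub> g) u \<otimes>\<^bsub>A\<^esub> h c"
    if "u \<in> carrier H" "c \<in> carrier H" for u c
  proof -
    have "tensor_lift k H H A (\<lambda>a b. f a \<otimes>\<^bsub>A\<^esub> g b \<otimes>\<^bsub>A\<^esub> h c) (\<Delta> u) =
        tensor_lift k H H A (\<lambda>a b. f a \<otimes>\<^bsub>A\<^esub> g b) (\<Delta> u) \<otimes>\<^bsub>A\<^esub> h c"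
      using that f g h
      by (intro tensor_lift_unique[OF Hm Hm Am
            k_linear_comp[OF mult_lift(1) k_bilinearD(2)[OF A.mult_bilinear]]])
        (simp_all add: mult_lift comult_closed carrierD)
    then show ?thesis using that by (simp add: convolution_simps)
  qed
  \<comment> \<open>Likewise for left multiplication by \<open>f a\<close>, after rebracketing in
    \<open>A\<close>.\<close>
  have lift_l: "tensor_lift k H H A (\<lambda>b c. f a \<otimes>\<^bsub>A\<^esub> g b \<otimes>\<^bsub>A\<^esub> h c) (\<Delta> v) = f a \<otimes>\<^bsub>A\<^esub> (g \<otimes>\<^bsub>C\<^esub> h) v"
    if "a \<in> carrier H" "v \<in> carrier H" for a v
  proof -
    have "tensor_lift k H H A (\<lambda>b c. f a \<otimes>\<^bsub>A\<^esub> g b \<otimes>\<^bsub>A\<^esub> h c) (\<Delta> v) =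
        f a \<otimes>\<^bsub>A\<^esub> tensor_lift k H H A (\<lambda>b c. g b \<otimes>\<^bsub>A\<^esub> h c) (\<Delta> v)"
      using that f g h
      by (intro tensor_lift_unique[OF Hm Hm Am
            k_linear_comp[OF mult_lift(1) k_bilinearD(1)[OF A.mult_bilinear]]])
        (simp_all add: mult_lift comult_closed carrierD A.m_assoc)
    then show ?thesis using that by (simp add: convolution_simps)
  qed
  have tri: "k_trilinear k H H H A (\<lambda>a b c. f a \<otimes>\<^bsub>A\<^esub> g b \<otimes>\<^bsub>A\<^esub> h c)"
    using f g h
    by (intro k_trilinearI k_linearI)
      (simp_all add: carrierD k_linearD[OF carrierD(1)] A.l_distr A.r_distr
        A.smult_mult_left A.smult_mult_right)
  have "((f \<otimes>\<^bsub>C\<^esub> g) \<otimes>\<^bsub>C\<^esub> h) x = tensor_lift k H H A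
      (\<lambda>u c. tensor_lift k H H A (\<lambda>a b. f a \<otimes>\<^bsub>A\<^esub> g b \<otimes>\<^bsub>A\<^esub> h c) (\<Delta> u)) (\<Delta> x)"
    using x lift_r by (simp add: convolution_simps(2)[of "f \<otimes>\<^bsub>C\<^esub> g" h] cong: tensor_lift_cong)
  also have "\<dots> = tensor_lift k H H A
      (\<lambda>a v. tensor_lift k H H A (\<lambda>b c. f a \<otimes>\<^bsub>A\<^esub> g b \<otimes>\<^bsub>A\<^esub> h c) (\<Delta> v)) (\<Delta> x)"
    by (rule coassoc_lift[OF Am tri x])
  also have "\<dots> = (f \<otimes>\<^bsub>C\<^esub> (g \<otimes>\<^bsub>C\<^esub> h)) x"
    using x lift_l by (simp add: convolution_simps(2)[of f "g \<otimes>\<^bsub>C\<^esub> h"] cong: tensor_lift_cong)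
  finally show "((f \<otimes>\<^bsub>C\<^esub> g) \<otimes>\<^bsub>C\<^esub> h) x = (f \<otimes>\<^bsub>C\<^esub> (g \<otimes>\<^bsub>C\<^esub> h)) x" .
qed (simp_all add: convolution_simps)

text \<open>By linearity \<open>\<epsilon>(u) f(v) = f(\<epsilon>(u) v)\<close>. Multiplying by the
  unit therefore applies \<open>f\<close> to the contraction of \<open>\<Delta> x\<close> by the
  counit, which is \<open>x\<close> by the counit axioms.\<close>

lemma one_mult:
  assumes f: "f \<in> carrier C"
  shows "\<one>\<^bsub>C\<^esub> \<otimes>\<^bsub>C\<^esub> f = f" "f \<otimes>\<^bsub>C\<^esub> \<one>\<^bsub>C\<^esub> = f"
proof -
  note Hm = H.module_axioms
  have eps: "\<epsilon> x \<in> carrier k" if "x \<in> carrier H" for x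
    using k_linearD(1)[OF H.counit_linear that] by (simp add: base_module_def)
  have b: "k_bilinear k H H H (\<lambda>x y. \<epsilon> x \<odot>\<^bsub>H\<^esub> y)"
    by (rule H.k_bilinear_smult[OF H.counit_linear])
  note b' = k_bilinear_swap[OF b]
  note fl = f[THEN carrierD(1)]
  show "\<one>\<^bsub>C\<^esub> \<otimes>\<^bsub>C\<^esub> f = f"
  proof (rule extensionalityI[of _ "carrier H"])
    fix x assume x: "x \<in> carrier H"
    have "(\<one>\<^bsub>C\<^esub> \<otimes>\<^bsub>C\<^esub> f) x = f (tensor_lift k H H H (\<lambda>x y. \<epsilon> x \<odot>\<^bsub>H\<^esub> y) (\<Delta> x))"
      using x
      by (intro mult_eqI k_linear_comp[OF tensor_lift_linear[OF Hm Hm Hm b] fl])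
        (simp_all add: tensor_lift_props(2)[OF Hm Hm Hm b] convolution_simps(3) eps
          k_linearD[OF fl] A.smult_mult_left)
    then show "(\<one>\<^bsub>C\<^esub> \<otimes>\<^bsub>C\<^esub> f) x = f x" using H.counit_left[OF x] by simp
  qed (simp_all add: convolution_simps(2) carrierD f)
  show "f \<otimes>\<^bsub>C\<^esub> \<one>\<^bsub>C\<^esub> = f"
  proof (rule extensionalityI[of _ "carrier H"])
    fix x assume x: "x \<in> carrier H"
    have "(f \<otimes>\<^bsub>C\<^esub> \<one>\<^bsub>C\<^esub>) x = f (tensor_lift k H H H (\<lambda>x y. \<epsilon> y \<odot>\<^bsub>H\<^esub> x) (\<Delta> x))"
      using x
      by (intro mult_eqI k_linear_comp[OF tensor_lift_linear[OF Hm Hm Hm b'] fl])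
        (simp_all add: tensor_lift_props(2)[OF Hm Hm Hm b'] convolution_simps(3) eps
          k_linearD[OF fl] A.smult_mult_right)
    then show "(f \<otimes>\<^bsub>C\<^esub> \<one>\<^bsub>C\<^esub>) x = f x" using H.counit_right[OF x] by simp
  qed (simp_all add: convolution_simps(2) carrierD f)
qed

lemma mult_add:
  assumes "f \<in> carrier C" "g \<in> carrier C" "h \<in> carrier C"
  shows "(f \<oplus>\<^bsub>C\<^esub> g) \<otimes>\<^bsub>C\<^esub> h = f \<otimes>\<^bsub>C\<^esub> h \<oplus>\<^bsub>C\<^esub> g \<otimes>\<^bsub>C\<^esub> h"
    and "h \<otimes>\<^bsub>C\<^esub> (f \<oplus>\<^bsub>C\<^esub> g) = h \<otimes>\<^bsub>C\<^esub> f \<oplus>\<^bsub>C\<^esub> h \<otimes>\<^bsub>C\<^esub> g"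
proof -
  note lin = k_linear_add[OF A.module_axioms mult_lift(1) mult_lift(1)]
  have "((f \<oplus>\<^bsub>C\<^esub> g) \<otimes>\<^bsub>C\<^esub> h) x = (f \<otimes>\<^bsub>C\<^esub> h \<oplus>\<^bsub>C\<^esub> g \<otimes>\<^bsub>C\<^esub> h) x" if x: "x \<in> carrier H" for x
    using assms x
    by (subst mult_eqI[OF lin[of f h g h]])
      (simp_all add: mult_lift convolution_simps(2,5) carrierD A.l_distr)
  then show "(f \<oplus>\<^bsub>C\<^esub> g) \<otimes>\<^bsub>C\<^esub> h = f \<otimes>\<^bsub>C\<^esub> h \<oplus>\<^bsub>C\<^esub> g \<otimes>\<^bsub>C\<^esub> h"
    by (intro extensionalityI[of _ "carrier H"]) (simp_all add: convolution_simps(2,5))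
  have "(h \<otimes>\<^bsub>C\<^esub> (f \<oplus>\<^bsub>C\<^esub> g)) x = (h \<otimes>\<^bsub>C\<^esub> f \<oplus>\<^bsub>C\<^esub> h \<otimes>\<^bsub>C\<^esub> g) x" if x: "x \<in> carrier H" for x
    using assms x
    by (subst mult_eqI[OF lin[of h f h g]])
      (simp_all add: mult_lift convolution_simps(2,5) carrierD A.r_distr)
  then show "h \<otimes>\<^bsub>C\<^esub> (f \<oplus>\<^bsub>C\<^esub> g) = h \<otimes>\<^bsub>C\<^esub> f \<oplus>\<^bsub>C\<^esub> h \<otimes>\<^bsub>C\<^esub> g"
    by (intro extensionalityI[of _ "carrier H"]) (simp_all add: convolution_simps(2,5))
qed

lemma mult_smult:
  assumes "r \<in> carrier k" "f \<in> carrier C" "g \<in> carrier C"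
  shows "(r \<odot>\<^bsub>C\<^esub> f) \<otimes>\<^bsub>C\<^esub> g = r \<odot>\<^bsub>C\<^esub> (f \<otimes>\<^bsub>C\<^esub> g)" "f \<otimes>\<^bsub>C\<^esub> (r \<odot>\<^bsub>C\<^esub> g) = r \<odot>\<^bsub>C\<^esub> (f \<otimes>\<^bsub>C\<^esub> g)"
proof -
  note lin = k_linear_smult[OF A.module_axioms assms(1) mult_lift(1)[OF assms(2,3)]]
  have "((r \<odot>\<^bsub>C\<^esub> f) \<otimes>\<^bsub>C\<^esub> g) x = (r \<odot>\<^bsub>C\<^esub> (f \<otimes>\<^bsub>C\<^esub> g)) x" if x: "x \<in> carrier H" for x
    using assms x
    by (subst mult_eqI[OF lin])
      (simp_all add: mult_lift convolution_simps(2,6) carrierD A.smult_mult_left)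
  then show "(r \<odot>\<^bsub>C\<^esub> f) \<otimes>\<^bsub>C\<^esub> g = r \<odot>\<^bsub>C\<^esub> (f \<otimes>\<^bsub>C\<^esub> g)"
    by (intro extensionalityI[of _ "carrier H"]) (simp_all add: convolution_simps(2,6))
  have "(f \<otimes>\<^bsub>C\<^esub> (r \<odot>\<^bsub>C\<^esub> g)) x = (r \<odot>\<^bsub>C\<^esub> (f \<otimes>\<^bsub>C\<^esub> g)) x" if x: "x \<in> carrier H" for x
    using assms x
    by (subst mult_eqI[OF lin])
      (simp_all add: mult_lift convolution_simps(2,6) carrierD A.smult_mult_right)
  then show "f \<otimes>\<^bsub>C\<^esub> (r \<odot>\<^bsub>C\<^esub> g) = r \<odot>\<^bsub>C\<^esub> (f \<otimes>\<^bsub>C\<^esub> g)"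
    by (intro extensionalityI[of _ "carrier H"]) (simp_all add: convolution_simps(2,6))
qed

lemma convolution_k_algebra: "k_algebra k C"
  by (intro k_algebra.intro k_algebra_axioms.intro convolution_module ringI monoidI
      C.abelian_group_axioms)
    (simp_all add: mult_closed one_closed mult_assoc one_mult mult_add mult_smult)

end

section \<open>The Rota-Baxter operator on the convolution algebra\<close>

lemma convolution_rota_baxter:
  assumes "coalgebra k H \<Delta> \<epsilon>" and "rota_baxter_algebra k A weight Q"
  shows "rota_baxter_algebra k (convolution_algebra k H \<Delta> \<epsilon> A) weight (hom_operator H Q)"
proof -
  interpret A: rota_baxter_algebra k A weight Q by fact
  interpret convolution k H \<Delta> \<epsilon> A
    by (intro convolution.intro assms A.k_algebra_axioms)
  note Q = A.operator_linear
  have P: "hom_operator H Q f x = Q (f x)" if "x \<in> carrier H" for f x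
    using that by (simp add: hom_operator_def compose_def)
  have Pc: "hom_operator H Q f \<in> carrier C" if "f \<in> carrier C" for f
    using restrict_linear_maps[OF H.module_axioms k_linear_comp[OF carrierD(1)[OF that] Q]]
    by (simp add: hom_operator_def compose_def convolution_simps)
  show ?thesis
  proof (intro rota_baxter_algebra.intro rota_baxter_algebra_axioms.intro
      convolution_k_algebra A.weight_closed k_linearI)
    fix f g assume f: "f \<in> carrier C" and g: "g \<in> carrier C"
    let ?P = "hom_operator H Q"
    show "?P (f \<oplus>\<^bsub>C\<^esub> g) = ?P f \<oplus>\<^bsub>C\<^esub> ?P g"
      using f g
      by (auto simp: convolution_simps(5) hom_operator_def compose_def carrierD k_linearD[OF Q]
          intro!: restrict_ext)
    show "?P f \<otimes>\<^bsub>C\<^esub> ?P g =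
      ?P (f \<otimes>\<^bsub>C\<^esub> ?P g) \<oplus>\<^bsub>C\<^esub> ?P (?P f \<otimes>\<^bsub>C\<^esub> g) \<oplus>\<^bsub>C\<^esub> weight \<odot>\<^bsub>C\<^esub> ?P (f \<otimes>\<^bsub>C\<^esub> g)" (is "?l = ?r")
    proof (rule extensionalityI[of _ "carrier H"])
      fix x assume x: "x \<in> carrier H"
      \<comment> \<open>The right side at \<open>x\<close> is a single linear function of
        \<open>\<Delta> x\<close>, built from lifts followed by \<open>Q\<close>. On an elementary
        tensor \<open>y \<otimes> z\<close> the claim becomes the Rota-Baxter identity of
        \<open>Q\<close> at \<open>f y\<close> and \<open>g z\<close>.\<close>
      note l = k_linear_comp[OF mult_lift(1) Q]
      note lin = k_linear_add[OF A.module_axioms k_linear_add[OF A.module_axioms l l]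
          k_linear_smult[OF A.module_axioms A.weight_closed l]]
      show "?l x = ?r x"
        using f g x
        by (subst mult_eqI[OF lin[OF f Pc[OF g] Pc[OF f] g f g]])
          (simp_all add: mult_lift Pc P carrierD A.rota_baxter convolution_simps(2,5,6))
    qed (simp_all add: convolution_simps)
  next
    fix r f assume "r \<in> carrier k" "f \<in> carrier C"
    then show "hom_operator H Q (r \<odot>\<^bsub>C\<^esub> f) = r \<odot>\<^bsub>C\<^esub> hom_operator H Q f"
      by (auto simp: convolution_simps(6) hom_operator_def compose_def carrierD k_linearD[OF Q]
          intro!: restrict_ext)
  qed (rule Pc)
qed


section \<open>The algebra of right \<open>A\<close>-linear endomorphisms of \<open>M \<otimes> A\<close>\<close>

locale scalar_extension = A: k_algebra k A + M: module k M
  for k :: "('k, 'z) ring_scheme" and A :: "('k, 'a, 'x) module_scheme"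
    and M :: "('k, 'm, 'y) module_scheme"
begin

abbreviation "T \<equiv> tensor_module k M A"
abbreviation "E \<equiv> endo_algebra k M A"
abbreviation "te \<equiv> tensor_elem k M A"
abbreviation "rm \<equiv> tensor_right_mult k M A"

lemmas MA = M.module_axioms A.module_axioms

sublocale T: module k T by (rule tensor_module_module[OF MA])

lemmas te_closed = tensor_elem_closed[OF MA]
lemmas te_simps = tensor_elem_simps[OF MA]
lemmas te_induct [consumes 1, case_names elem add] = tensor_induct[OF MA]

section \<open>The right action of \<open>A\<close> on \<open>M \<otimes> A\<close>\<close>

lemma rm_linear: "a \<in> carrier A \<Longrightarrow> k_linear k T T (\<lambda>t. rm t a)"
  unfolding tensor_right_mult_def
  by (intro tensor_map_linear MA k_linear_id k_bilinearD(2)[OF A.mult_bilinear])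

lemma rm_elem:
  assumes "m \<in> carrier M" "b \<in> carrier A" "a \<in> carrier A"
  shows "rm (te m b) a = te m (b \<otimes>\<^bsub>A\<^esub> a)"
  unfolding tensor_right_mult_def using assms
  by (intro tensor_map_props(2) MA k_linear_id k_bilinearD(2)[OF A.mult_bilinear])

lemmas rm_simps = k_linearD[OF rm_linear]

text \<open>Linearity in the tensor comes from \<open>tensor_map\<close>; the laws in the acting
  element are proved by induction on the tensor, where they reduce to laws of \<open>A\<close> in
  the second factor.\<close>

lemma rm_right:
  assumes t: "t \<in> carrier T" and a: "a \<in> carrier A"
  shows "b \<in> carrier A \<Longrightarrow> rm t (a \<oplus>\<^bsub>A\<^esub> b) = rm t a \<oplus>\<^bsub>T\<^esub> rm t b"
    and "r \<in> carrier k \<Longrightarrow> rm t (r \<odot>\<^bsub>A\<^esub> a) = r \<odot>\<^bsub>T\<^esub> rm t a"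
    and "b \<in> carrier A \<Longrightarrow> rm t (a \<otimes>\<^bsub>A\<^esub> b) = rm (rm t a) b"
proof -
  show "rm t (a \<oplus>\<^bsub>A\<^esub> b) = rm t a \<oplus>\<^bsub>T\<^esub> rm t b" if "b \<in> carrier A"
    using t by (induction rule: te_induct)
      (use a that in \<open>simp_all add: rm_elem A.r_distr te_simps rm_simps T.M.a_ac\<close>)
  show "rm t (r \<odot>\<^bsub>A\<^esub> a) = r \<odot>\<^bsub>T\<^esub> rm t a" if "r \<in> carrier k"
    using t by (induction rule: te_induct)
      (use a that in \<open>simp_all add: rm_elem A.smult_mult_right te_simps rm_simps T.smult_r_distr\<close>)
  show "rm t (a \<otimes>\<^bsub>A\<^esub> b) = rm (rm t a) b" if "b \<in> carrier A"
    using t by (induction rule: te_induct)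
      (use a that in \<open>simp_all add: rm_elem A.m_assoc rm_simps\<close>)
qed

lemma rm_one: "t \<in> carrier T \<Longrightarrow> rm t \<one>\<^bsub>A\<^esub> = t"
  by (induction rule: te_induct) (simp_all add: rm_elem rm_simps)

lemma rm_bilinear: "k_bilinear k T A T rm"
  by (intro k_bilinearI k_linearI) (simp_all add: rm_simps rm_right)

section \<open>Endomorphisms linear over \<open>A\<close>\<close>

lemma endo_simps:
  "f \<otimes>\<^bsub>E\<^esub> g = compose (carrier T) f g"
  "\<one>\<^bsub>E\<^esub> = (\<lambda>t\<in>carrier T. t)"
  "\<zero>\<^bsub>E\<^esub> = (\<lambda>t\<in>carrier T. \<zero>\<^bsub>T\<^esub>)"
  "f \<oplus>\<^bsub>E\<^esub> g = (\<lambda>t\<in>carrier T. f t \<oplus>\<^bsub>T\<^esub> g t)"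
  "r \<odot>\<^bsub>E\<^esub> f = (\<lambda>t\<in>carrier T. r \<odot>\<^bsub>T\<^esub> f t)"
  by (simp_all add: endo_algebra_def Let_def)

lemma endo_carrier: "g \<in> carrier E \<longleftrightarrow> g \<in> carrier T \<rightarrow>\<^sub>E carrier T \<and>
    (\<forall>s\<in>carrier T. \<forall>t\<in>carrier T. g (s \<oplus>\<^bsub>T\<^esub> t) = g s \<oplus>\<^bsub>T\<^esub> g t) \<and>
    (\<forall>t\<in>carrier T. \<forall>a\<in>carrier A. g (rm t a) = rm (g t) a)"
  by (simp add: endo_algebra_def Let_def)

lemma endoD:
  assumes "g \<in> carrier E"
  shows "g \<in> extensional (carrier T)"
    and "t \<in> carrier T \<Longrightarrow> g t \<in> carrier T"
    and "\<lbrakk>s \<in> carrier T; t \<in> carrier T\<rbrakk> \<Longrightarrow> g (s \<oplus>\<^bsub>T\<^esub> t) = g s \<oplus>\<^bsub>T\<^esub> g t"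
    and "\<lbrakk>t \<in> carrier T; a \<in> carrier A\<rbrakk> \<Longrightarrow> g (rm t a) = rm (g t) a"
  using assms by (auto simp: endo_carrier PiE_def)

lemma endoI:
  assumes "g \<in> extensional (carrier T)" "k_linear k T T g"
    and "\<And>t a. \<lbrakk>t \<in> carrier T; a \<in> carrier A\<rbrakk> \<Longrightarrow> g (rm t a) = rm (g t) a"
  shows "g \<in> carrier E"
  using assms by (auto simp: endo_carrier k_linear_def PiE_def)

text \<open>Scalars act on \<open>M \<otimes> A\<close> through \<open>r \<odot> 1\<close> from the right.\<close>

lemma endo_linear:
  assumes "g \<in> carrier E"
  shows "k_linear k T T g"
proof (rule k_linearI)
  fix r t assume r: "r \<in> carrier k" and t: "t \<in> carrier T"
  have *: "rm s (r \<odot>\<^bsub>A\<^esub> \<one>\<^bsub>A\<^esub>) = r \<odot>\<^bsub>T\<^esub> s" if "s \<in> carrier T" for s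
    using r that by (simp add: rm_right rm_one)
  show "g (r \<odot>\<^bsub>T\<^esub> t) = r \<odot>\<^bsub>T\<^esub> g t"
    using endoD(4)[OF assms t, of "r \<odot>\<^bsub>A\<^esub> \<one>\<^bsub>A\<^esub>"] r t by (simp add: * endoD[OF assms])
qed (simp_all add: endoD[OF assms])

lemma endo_smult:
  "\<lbrakk>g \<in> carrier E; r \<in> carrier k; t \<in> carrier T\<rbrakk> \<Longrightarrow> g (r \<odot>\<^bsub>T\<^esub> t) = r \<odot>\<^bsub>T\<^esub> g t"
  by (rule k_linearD(3)[OF endo_linear])

text \<open>Since \<open>m \<otimes> a = (m \<otimes> 1) a\<close>, values at the elements
  \<open>m \<otimes> 1\<close> determine those at all elementary tensors.\<close>

lemma endo_eqI:
  assumes f: "f \<in> carrier E" and g: "g \<in> carrier E"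
    and eq: "\<And>m. m \<in> carrier M \<Longrightarrow> f (te m \<one>\<^bsub>A\<^esub>) = g (te m \<one>\<^bsub>A\<^esub>)"
  shows "f = g"
proof (rule extensionalityI)
  fix t assume "t \<in> carrier T"
  then show "f t = g t"
  proof (rule tensor_map_ext[OF MA endo_linear[OF f] endo_linear[OF g], rotated])
    fix m a assume ma: "m \<in> carrier M" "a \<in> carrier A"
    have "f (rm (te m \<one>\<^bsub>A\<^esub>) a) = g (rm (te m \<one>\<^bsub>A\<^esub>) a)"
      using ma by (simp add: endoD[OF f] endoD[OF g] te_closed eq)
    then show "f (te m a) = g (te m a)"
      using ma by (simp add: rm_elem)
  qed
qed (rule endoD[OF f] endoD[OF g])+

lemma endo_module: "module k E"
proof (rule pointwise_module[OF T.module_axioms])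
  show "carrier E \<subseteq> carrier T \<rightarrow>\<^sub>E carrier T"
    by (intro subsetI) (simp add: endo_carrier)
  show "\<zero>\<^bsub>E\<^esub> \<in> carrier E"
    \<comment> \<open>The zero map commutes with the action because \<open>0 a = 0\<close>.\<close>
    using k_linear_zero_minus(1)[OF T.module_axioms T.module_axioms rm_linear]
    by (auto simp: endo_carrier endo_simps rm_simps)
  show "f \<oplus>\<^bsub>E\<^esub> g \<in> carrier E" if "f \<in> carrier E" "g \<in> carrier E" for f g
    using that unfolding endo_carrier[of "f \<oplus>\<^bsub>E\<^esub> g"]
    by (simp add: endo_simps endoD rm_simps T.M.a_ac)
  show "r \<odot>\<^bsub>E\<^esub> f \<in> carrier E" if "r \<in> carrier k" "f \<in> carrier E" for r f
    using that unfolding endo_carrier[of "r \<odot>\<^bsub>E\<^esub> f"]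
    by (simp add: endo_simps endoD rm_simps T.smult_r_distr)
qed (simp_all add: endo_simps)

sublocale E: module k E by (rule endo_module)

lemma endo_mult_closed: "\<lbrakk>f \<in> carrier E; g \<in> carrier E\<rbrakk> \<Longrightarrow> f \<otimes>\<^bsub>E\<^esub> g \<in> carrier E"
  unfolding endo_carrier[of "f \<otimes>\<^bsub>E\<^esub> g"]
  by (simp add: endo_simps compose_def endoD rm_simps)

lemma endo_one_closed: "\<one>\<^bsub>E\<^esub> \<in> carrier E"
  by (auto simp: endo_carrier endo_simps rm_simps)

lemma endo_apply:
  assumes "t \<in> carrier T"
  shows "(f \<otimes>\<^bsub>E\<^esub> g) t = f (g t)" "\<one>\<^bsub>E\<^esub> t = t" "(f \<oplus>\<^bsub>E\<^esub> g) t = f t \<oplus>\<^bsub>T\<^esub> g t" "(r \<odot>\<^bsub>E\<^esub> f) t = r \<odot>\<^bsub>T\<^esub> f t"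
  using assms by (simp_all add: endo_simps compose_def)

text \<open>The laws are compared at \<open>m \<otimes> 1\<close>. Pulling a scalar out of the right
  factor of a composition uses \<open>endo_smult\<close>, that is, the \<open>k\<close>-linearity
  derived from \<open>A\<close>-linearity.\<close>

lemma endo_k_algebra: "k_algebra k E"
proof (intro k_algebra.intro k_algebra_axioms.intro endo_module ringI monoidI
    E.abelian_group_axioms)
qed (auto intro!: endo_eqI simp: endo_mult_closed endo_one_closed endo_apply te_closed endoD endo_smult)

text \<open>Since \<open>M \<otimes> A\<close> is induced from \<open>M\<close>, linear maps \<open>u : M \<rightarrow> M \<otimes> A\<close> extend uniquely to
  right \<open>A\<close>-linear endomorphisms; both \<open>endo_operator\<close> and \<open>comodule_rep\<close> take this form.\<close>

definition extend_endo where "extend_endo u = tensor_lift k M A T (\<lambda>m a. rm (u m) a)"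

text \<open>Right \<open>A\<close>-linearity of the extension is associativity of the action:
  \<open>u(m) (b a) = (u(m) b) a\<close>.\<close>

lemma extend_endo:
  assumes u: "k_linear k M T u"
  shows "extend_endo u \<in> carrier E"
    and "\<lbrakk>m \<in> carrier M; a \<in> carrier A\<rbrakk> \<Longrightarrow> extend_endo u (te m a) = rm (u m) a"
proof -
  note b = k_bilinear_comp[OF rm_bilinear u k_linear_id]
  note props = tensor_lift_props[OF MA T.module_axioms b]
  show el: "extend_endo u (te m a) = rm (u m) a" if "m \<in> carrier M" "a \<in> carrier A" for m a
    using that by (simp add: extend_endo_def props)
  have lin: "k_linear k T T (extend_endo u)"
    unfolding extend_endo_def by (rule tensor_lift_linear[OF MA T.module_axioms b])
  show "extend_endo u \<in> carrier E"
  proof (rule endoI[OF _ lin])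
    show "extend_endo u \<in> extensional (carrier T)"
      using props(1) by (simp add: extend_endo_def linear_maps_iff)
    fix t a assume "t \<in> carrier T" and a: "a \<in> carrier A"
    then show "extend_endo u (rm t a) = rm (extend_endo u t) a"
      by (induction rule: te_induct)
        (simp_all add: rm_elem el rm_right rm_simps k_linearD[OF u] k_linearD[OF lin])
  qed
qed

end

section \<open>The Rota-Baxter operator on endomorphisms and the Rota-Baxter module
  \<open>M \<otimes> A\<close>\<close>

locale scalar_extension_rb = scalar_extension k A M + A: rota_baxter_algebra k A weight Q
  for k :: "('k, 'z) ring_scheme" and A :: "('k, 'a, 'x) module_scheme"
    and M :: "('k, 'm, 'y) module_scheme" and weight and Q
begin

abbreviation "p \<equiv> tensor_operator k M A Q"
abbreviation "\<Q> \<equiv> endo_operator k M A Q"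

lemma p_linear: "k_linear k T T p"
  unfolding tensor_operator_def by (intro tensor_map_linear MA k_linear_id A.operator_linear)

lemmas p_simps = k_linearD[OF p_linear]

lemma p_elem: "\<lbrakk>m \<in> carrier M; a \<in> carrier A\<rbrakk> \<Longrightarrow> p (te m a) = te m (Q a)"
  unfolding tensor_operator_def by (intro tensor_map_props(2) MA k_linear_id A.operator_linear)

lemma Q_closed: "a \<in> carrier A \<Longrightarrow> Q a \<in> carrier A"
  by (rule k_linearD(1)[OF A.operator_linear])

text \<open>For \<open>s = m \<otimes> b\<close> this is \<open>m\<close> tensored with the
  Rota-Baxter identity of \<open>Q\<close> at \<open>b\<close> and \<open>a\<close>; both sides are
  additive in \<open>s\<close>.\<close>

lemma rm_rota_baxter:
  assumes "s \<in> carrier T" and a: "a \<in> carrier A"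
  shows "rm (p s) (Q a) =
    p (rm s (Q a)) \<oplus>\<^bsub>T\<^esub> p (rm (p s) a) \<oplus>\<^bsub>T\<^esub> weight \<odot>\<^bsub>T\<^esub> p (rm s a)"
  using assms(1)
proof (induction rule: te_induct)
  case (elem m b)
  then show ?case
    using a by (simp add: p_elem rm_elem Q_closed A.rota_baxter te_simps A.weight_closed)
next
  case (add s t)
  then show ?case
    using a by (simp add: p_simps rm_simps Q_closed A.weight_closed T.smult_r_distr T.M.a_ac)
qed

lemma operator_endo_linear:
  assumes g: "g \<in> carrier E"
  shows "k_linear k M T (\<lambda>m. p (g (te m \<one>\<^bsub>A\<^esub>)))"
  by (intro k_linear_comp[OF k_linear_comp[OF k_bilinearD(2)[OF tensor_elem_bilinear[OF MA]]
        endo_linear[OF g]] p_linear] A.one_closed)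

text \<open>Puts the operator into the form for which \<open>extend_endo\<close> supplies
  \<open>A\<close>-linearity and the values on elementary tensors.\<close>

lemma operator_extend: "\<Q> g = extend_endo (\<lambda>m. p (g (te m \<one>\<^bsub>A\<^esub>)))"
  by (simp add: extend_endo_def endo_operator_def)

lemma operator_closed: "g \<in> carrier E \<Longrightarrow> \<Q> g \<in> carrier E"
  unfolding operator_extend by (intro extend_endo operator_endo_linear)

lemma operator_elem:
  "\<lbrakk>g \<in> carrier E; m \<in> carrier M; a \<in> carrier A\<rbrakk> \<Longrightarrow> \<Q> g (te m a) = rm (p (g (te m \<one>\<^bsub>A\<^esub>))) a"
  unfolding operator_extend by (intro extend_endo operator_endo_linear)

text \<open>Together with \<open>endo_eqI\<close> this turns identities for \<open>\<Q>\<close> into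
  identities for \<open>p\<close>.\<close>

lemma operator_elem_one:
  "\<lbrakk>g \<in> carrier E; m \<in> carrier M\<rbrakk> \<Longrightarrow> \<Q> g (te m \<one>\<^bsub>A\<^esub>) = p (g (te m \<one>\<^bsub>A\<^esub>))"
  by (simp add: operator_elem rm_one p_simps endoD te_closed)

text \<open>On \<open>m \<otimes> a\<close> this is \<open>rm_rota_baxter\<close> for
  \<open>s = g(m \<otimes> 1)\<close>; additivity extends it to all tensors. It serves both the
  module structure and the Rota-Baxter identity of \<open>\<Q>\<close>.\<close>

lemma endo_module_rota_baxter:
  assumes g: "g \<in> carrier E" and "t \<in> carrier T"
  shows "\<Q> g (p t) = p (g (p t)) \<oplus>\<^bsub>T\<^esub> p (\<Q> g t) \<oplus>\<^bsub>T\<^esub> weight \<odot>\<^bsub>T\<^esub> p (g t)"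
  using assms(2)
proof (induction rule: te_induct)
  case (elem m a)
  let ?s = "g (te m \<one>\<^bsub>A\<^esub>)"
  have s: "?s \<in> carrier T" using elem by (simp add: endoD[OF g] te_closed)
  \<comment> \<open>\<open>A\<close>-linearity of \<open>g\<close> lets terms of the form
    \<open>s b\<close> be read as values of \<open>g\<close> at
    \<open>m \<otimes> b\<close>.\<close>
  have gb: "g (te m b) = rm ?s b" if "b \<in> carrier A" for b
    using endoD(4)[OF g te_closed[OF elem(1) A.one_closed] that] elem that by (simp add: rm_elem)
  show ?case
    using elem rm_rota_baxter[OF s elem(2)]
    by (simp add: p_elem operator_elem[OF g] Q_closed gb[symmetric])
next
  case (add s t)
  then show ?case
    by (simp add: p_simps endoD[OF g] endoD[OF operator_closed[OF g]] A.weight_closed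
        T.smult_r_distr T.M.a_ac)
qed

lemma endo_rota_baxter: "rota_baxter_algebra k E weight \<Q>"
proof (intro rota_baxter_algebra.intro rota_baxter_algebra_axioms.intro
    endo_k_algebra A.weight_closed k_linearI operator_closed)
  fix f g assume f: "f \<in> carrier E" and g: "g \<in> carrier E"
  show "\<Q> (f \<oplus>\<^bsub>E\<^esub> g) = \<Q> f \<oplus>\<^bsub>E\<^esub> \<Q> g"
    using f g
    by (intro endo_eqI)
      (simp_all add: operator_closed operator_elem_one endo_apply te_closed p_simps endoD)
  \<comment> \<open>At \<open>m \<otimes> 1\<close> the left side is \<open>\<Q> f (p t)\<close>
    with \<open>t = g (m \<otimes> 1)\<close>. The module identity for \<open>f\<close> at
    \<open>t\<close> expands it into three terms, which are the values at
    \<open>m \<otimes> 1\<close> of the three summands on the right.\<close>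
  show "\<Q> f \<otimes>\<^bsub>E\<^esub> \<Q> g =
      \<Q> (f \<otimes>\<^bsub>E\<^esub> \<Q> g) \<oplus>\<^bsub>E\<^esub> \<Q> (\<Q> f \<otimes>\<^bsub>E\<^esub> g) \<oplus>\<^bsub>E\<^esub> weight \<odot>\<^bsub>E\<^esub> \<Q> (f \<otimes>\<^bsub>E\<^esub> g)"
    using f g
    by (intro endo_eqI)
      (simp_all add: operator_closed endo_mult_closed operator_elem_one endo_apply te_closed
        endoD endo_module_rota_baxter A.weight_closed)
next
  fix r f assume "r \<in> carrier k" "f \<in> carrier E"
  then show "\<Q> (r \<odot>\<^bsub>E\<^esub> f) = r \<odot>\<^bsub>E\<^esub> \<Q> f"
    by (intro endo_eqI)
      (simp_all add: operator_closed operator_elem_one endo_apply te_closed p_simps endoD)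
qed

lemma endo_rota_baxter_module:
  "rota_baxter_module k E weight \<Q> T (\<lambda>g t. g t) p"
  by (intro rota_baxter_module.intro rota_baxter_module_axioms.intro endo_rota_baxter
      T.module_axioms p_linear endo_module_rota_baxter)
    (simp_all add: endo_apply endoD)

end


section \<open>The representation of the convolution algebra\<close>

locale comodule_rb = right_comodule k H \<Delta> \<epsilon> M \<delta> + E: scalar_extension_rb k A M weight Q
  for k :: "('k, 'z) ring_scheme" and H :: "('k, 'h, 'w) module_scheme" and \<Delta> \<epsilon>
    and M :: "('k, 'm, 'y) module_scheme" and \<delta>
    and A :: "('k, 'a, 'x) module_scheme" and weight and Q
begin

sublocale C: convolution k H \<Delta> \<epsilon> A
  by (intro convolution.intro coalgebra_axioms E.A.k_algebra_axioms)

abbreviation "\<phi> \<equiv> comodule_rep k H M \<delta> A"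

text \<open>This is \<open>id \<otimes> f\<close>, from \<open>M \<otimes> H\<close> to
  \<open>M \<otimes> A\<close>; its value at \<open>\<delta> m\<close> is
  \<open>\<phi>(f)(m \<otimes> 1)\<close>.\<close>

abbreviation "pushforward f \<equiv> tensor_map k M H M A (\<lambda>x. x) f"

lemmas MH = E.MA(1) module_axioms

lemma coaction_closed: "m \<in> carrier M \<Longrightarrow> \<delta> m \<in> carrier (tensor_module k M H)"
  by (rule k_linearD(1)[OF coaction_linear])

lemma pushforward:
  assumes "k_linear k H A f"
  shows "k_linear k (tensor_module k M H) E.T (pushforward f)"
    and "\<lbrakk>m \<in> carrier M; h \<in> carrier H\<rbrakk> \<Longrightarrow> pushforward f (tensor_elem k M H m h) = E.te m (f h)"
  using tensor_map_linear[OF MH E.MA k_linear_id assms]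
    tensor_map_props(2)[OF MH E.MA k_linear_id assms] by simp_all

text \<open>Moves the factor \<open>a\<close> from inside the Sweedler sum defining
  \<open>\<phi>\<close> to the right action on the whole sum.\<close>

lemma pushforward_rm:
  assumes f: "k_linear k H A f" and a: "a \<in> carrier A" and t: "t \<in> carrier (tensor_module k M H)"
  shows "pushforward (\<lambda>h. f h \<otimes>\<^bsub>A\<^esub> a) t = E.rm (pushforward f t) a"
proof -
  have fa: "k_linear k H A (\<lambda>h. f h \<otimes>\<^bsub>A\<^esub> a)"
    by (rule k_linear_comp[OF f k_bilinearD(2)[OF E.A.mult_bilinear a]])
  show ?thesis
    by (rule tensor_map_ext[OF MH pushforward(1)[OF fa]
          k_linear_comp[OF pushforward(1)[OF f] E.rm_linear[OF a]] _ t])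
      (simp add: pushforward(2)[OF fa] pushforward(2)[OF f] E.rm_elem a k_linearD(1)[OF f])
qed

text \<open>Identifies \<open>\<phi> f\<close> as the endomorphism induced by the linear map
  \<open>(id \<otimes> f) \<circ> \<delta>\<close>, so its \<open>A\<close>-linearity comes from
  \<open>extend_endo\<close>.\<close>

lemma rep_extend:
  assumes "k_linear k H A f"
  shows "\<phi> f = E.extend_endo (\<lambda>m. pushforward f (\<delta> m))"
  unfolding comodule_rep_def E.extend_endo_def
  by (intro tensor_lift_cong pushforward_rm assms coaction_closed)

lemma rep:
  assumes "f \<in> carrier C.C"
  shows "\<phi> f \<in> carrier E.E"
    and "\<lbrakk>m \<in> carrier M; a \<in> carrier A\<rbrakk> \<Longrightarrow> \<phi> f (E.te m a) = E.rm (pushforward f (\<delta> m)) a"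
    and "m \<in> carrier M \<Longrightarrow> \<phi> f (E.te m \<one>\<^bsub>A\<^esub>) = pushforward f (\<delta> m)"
proof -
  note f = C.carrierD(1)[OF assms]
  note u = k_linear_comp[OF coaction_linear pushforward(1)[OF f]]
  show "\<phi> f \<in> carrier E.E"
    unfolding rep_extend[OF f] by (rule E.extend_endo[OF u])
  show *: "\<phi> f (E.te m a) = E.rm (pushforward f (\<delta> m)) a" if "m \<in> carrier M" "a \<in> carrier A" for m a
    unfolding rep_extend[OF f] by (rule E.extend_endo(2)[OF u that])
  show "\<phi> f (E.te m \<one>\<^bsub>A\<^esub>) = pushforward f (\<delta> m)" if "m \<in> carrier M"
    using that by (simp add: * E.rm_one k_linearD(1)[OF u])
qed

text \<open>Two reductions in one: endomorphisms are compared at \<open>m \<otimes> 1\<close>, and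
  \<open>id \<otimes> f\<close> is replaced by any linear \<open>u\<close> on
  \<open>M \<otimes> H\<close> with the same values on elementary tensors.\<close>

lemma rep_eqI:
  assumes f: "f \<in> carrier C.C" and g: "g \<in> carrier E.E" and u: "k_linear k (tensor_module k M H) E.T u"
    and "\<And>m h. \<lbrakk>m \<in> carrier M; h \<in> carrier H\<rbrakk> \<Longrightarrow> u (tensor_elem k M H m h) = E.te m (f h)"
    and "\<And>m. m \<in> carrier M \<Longrightarrow> u (\<delta> m) = g (E.te m \<one>\<^bsub>A\<^esub>)"
  shows "\<phi> f = g"
proof (rule E.endo_eqI[OF rep(1)[OF f] g])
  fix m assume m: "m \<in> carrier M"
  have "pushforward f (\<delta> m) = u (\<delta> m)"
    by (rule tensor_map_ext[OF MH pushforward(1)[OF C.carrierD(1)[OF f]] u _ coaction_closed[OF m]])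
      (simp add: pushforward(2)[OF C.carrierD(1)[OF f]] assms(4))
  then show "\<phi> f (E.te m \<one>\<^bsub>A\<^esub>) = g (E.te m \<one>\<^bsub>A\<^esub>)"
    using m by (simp add: rep(3)[OF f] assms(5))
qed

section \<open>Compatibility of \<open>\<phi>\<close> with sums, products, operators and
  units\<close>

interpretation CM: k_algebra k C.C by (rule C.convolution_k_algebra)

text \<open>\<open>rep_eqI\<close> is used with the sum, respectively the scalar multiple, of
  pushforwards as the map on \<open>M \<otimes> H\<close>.\<close>

lemma rep_linear: "k_linear k C.C E.E \<phi>"
proof (rule k_linearI)
  fix f g assume f: "f \<in> carrier C.C" and g: "g \<in> carrier C.C"
  note pf = pushforward[OF C.carrierD(1)[OF f]] and pg = pushforward[OF C.carrierD(1)[OF g]]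
  show "\<phi> (f \<oplus>\<^bsub>C.C\<^esub> g) = \<phi> f \<oplus>\<^bsub>E.E\<^esub> \<phi> g"
    by (rule rep_eqI[OF _ _ k_linear_add[OF E.T.module_axioms pf(1) pg(1)]])
      (simp_all add: f g rep(1,3) pf(2) pg(2) E.endo_apply E.te_closed E.te_simps C.carrierD
        C.convolution_apply)
next
  fix r f assume r: "r \<in> carrier k" and f: "f \<in> carrier C.C"
  note pf = pushforward[OF C.carrierD(1)[OF f]]
  show "\<phi> (r \<odot>\<^bsub>C.C\<^esub> f) = r \<odot>\<^bsub>E.E\<^esub> \<phi> f"
    by (rule rep_eqI[OF _ _ k_linear_smult[OF E.T.module_axioms r pf(1)]])
      (simp_all add: r f rep(1,3) pf(2) E.endo_apply E.te_closed E.te_simps C.carrierD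
        C.convolution_apply)
qed (rule rep)

text \<open>At \<open>m \<otimes> 1\<close> both sides are sums of
  \<open>x \<otimes> f(b) g(c)\<close>: composing endomorphisms iterates the coaction, while the
  convolution product applies \<open>\<Delta>\<close> to the \<open>H\<close>-factor.
  Coassociativity equates the two.\<close>

lemma rep_mult:
  assumes f: "f \<in> carrier C.C" and g: "g \<in> carrier C.C"
  shows "\<phi> (f \<otimes>\<^bsub>C.C\<^esub> g) = \<phi> f \<otimes>\<^bsub>E.E\<^esub> \<phi> g"
proof (rule E.endo_eqI)
  note fl = C.carrierD(1)[OF f] and gl = C.carrierD(1)[OF g]
  note fg = C.mult_closed[OF f g]
  note Tm = E.T.module_axioms
  have F: "k_trilinear k M H H E.T (\<lambda>x b c. E.te x (f b \<otimes>\<^bsub>A\<^esub> g c))"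
    using f g
    by (intro k_trilinearI k_linearI)
      (simp_all add: C.carrierD k_linearD[OF fl] k_linearD[OF gl] E.A.l_distr E.A.r_distr
        E.A.smult_mult_left E.A.smult_mult_right E.te_simps E.te_closed)
  fix m assume m: "m \<in> carrier M"
  \<comment> \<open>Summing over the inner coaction \<open>\<delta> x\<close> with \<open>c\<close>
    fixed gives \<open>\<phi> f\<close> at \<open>x \<otimes> g c\<close>, because the factor
    \<open>g c\<close> acts from the right.\<close>
  have inner: "tensor_lift k M H E.T (\<lambda>a b. E.te a (f b \<otimes>\<^bsub>A\<^esub> g c)) (\<delta> x) = \<phi> f (E.te x (g c))"
    if x: "x \<in> carrier M" and c: "c \<in> carrier H" for x c
  proof -
    have gc: "g c \<in> carrier A" using C.carrierD(3)[OF g c] .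
    have "tensor_lift k M H E.T (\<lambda>a b. E.te a (f b \<otimes>\<^bsub>A\<^esub> g c)) (\<delta> x) =
        E.rm (pushforward f (\<delta> x)) (g c)"
      by (rule tensor_lift_unique[OF MH Tm k_linear_comp[OF pushforward(1)[OF fl]
              E.rm_linear[OF gc]] _ coaction_closed[OF x]])
        (simp add: pushforward(2)[OF fl] E.rm_elem gc C.carrierD(3)[OF f])
    then show ?thesis using x gc by (simp add: rep(2)[OF f])
  qed
  have "(\<phi> f \<otimes>\<^bsub>E.E\<^esub> \<phi> g) (E.te m \<one>\<^bsub>A\<^esub>) = \<phi> f (pushforward g (\<delta> m))"
    using m by (simp add: E.endo_apply E.te_closed rep(3)[OF g])
  also have "\<dots> = tensor_lift k M H E.T (\<lambda>x c. \<phi> f (E.te x (g c))) (\<delta> m)"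
    by (rule tensor_lift_unique[OF MH Tm k_linear_comp[OF pushforward(1)[OF gl]
            E.endo_linear[OF rep(1)[OF f]]] _ coaction_closed[OF m], symmetric])
      (simp add: pushforward(2)[OF gl])
  also have "\<dots> = tensor_lift k M H E.T
      (\<lambda>x c. tensor_lift k M H E.T (\<lambda>a b. E.te a (f b \<otimes>\<^bsub>A\<^esub> g c)) (\<delta> x)) (\<delta> m)"
    by (simp add: inner cong: tensor_lift_cong)
  also have "\<dots> = tensor_lift k M H E.T
      (\<lambda>a v. tensor_lift k H H E.T (\<lambda>b c. E.te a (f b \<otimes>\<^bsub>A\<^esub> g c)) (\<Delta> v)) (\<delta> m)"
    by (rule coassoc_lift[OF Tm F m])
  also have "\<dots> = pushforward (f \<otimes>\<^bsub>C.C\<^esub> g) (\<delta> m)"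
  proof (rule tensor_lift_unique[OF MH Tm pushforward(1)[OF C.carrierD(1)[OF fg]] _
        coaction_closed[OF m]])
    fix a v assume a: "a \<in> carrier M" and v: "v \<in> carrier H"
    \<comment> \<open>For fixed \<open>a\<close>, tensoring with \<open>a\<close> is linear and so
      passes out of the lift over \<open>\<Delta> v\<close>, leaving the convolution product at
      \<open>v\<close>.\<close>
    have "tensor_lift k H H E.T (\<lambda>b c. E.te a (f b \<otimes>\<^bsub>A\<^esub> g c)) (\<Delta> v) =
        E.te a (tensor_lift k H H A (\<lambda>b c. f b \<otimes>\<^bsub>A\<^esub> g c) (\<Delta> v))"
      by (rule tensor_lift_unique[OF MH(2) MH(2) Tm k_linear_comp[OF C.mult_lift(1)[OF f g]
              k_bilinearD(1)[OF tensor_elem_bilinear[OF E.MA] a]] _ C.comult_closed[OF v]])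
        (simp add: C.mult_lift(2)[OF f g])
    then show "pushforward (f \<otimes>\<^bsub>C.C\<^esub> g) (tensor_elem k M H a v) =
        tensor_lift k H H E.T (\<lambda>b c. E.te a (f b \<otimes>\<^bsub>A\<^esub> g c)) (\<Delta> v)"
      using a v by (simp add: pushforward(2)[OF C.carrierD(1)[OF fg]] C.convolution_apply)
  qed
  finally show "\<phi> (f \<otimes>\<^bsub>C.C\<^esub> g) (E.te m \<one>\<^bsub>A\<^esub>) = (\<phi> f \<otimes>\<^bsub>E.E\<^esub> \<phi> g) (E.te m \<one>\<^bsub>A\<^esub>)"
    using m by (simp add: rep(3)[OF fg])
qed (simp_all add: rep f g C.mult_closed E.endo_mult_closed)

text \<open>Functoriality, \<open>(id \<otimes> Q) \<circ> (id \<otimes> f) = id \<otimes> (Q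
  \<circ> f)\<close>, evaluated at \<open>\<delta> m\<close>.\<close>

lemma rep_operator:
  assumes f: "f \<in> carrier C.C" and Pf: "hom_operator H Q f \<in> carrier C.C"
  shows "E.\<Q> (\<phi> f) = \<phi> (hom_operator H Q f)"
proof (rule rep_eqI[OF Pf, symmetric])
  note pf = pushforward[OF C.carrierD(1)[OF f]]
  show "k_linear k (tensor_module k M H) E.T (\<lambda>t. E.p (pushforward f t))"
    by (rule k_linear_comp[OF pf(1) E.p_linear])
  show "E.p (pushforward f (tensor_elem k M H m h)) = E.te m (hom_operator H Q f h)"
    if "m \<in> carrier M" "h \<in> carrier H" for m h
    using that by (simp add: pf(2) E.p_elem C.carrierD(3)[OF f] hom_operator_def compose_def)
qed (simp_all add: E.operator_closed E.operator_elem_one rep(1,3) f)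

text \<open>Moving the scalar across the tensor gives
  \<open>x \<otimes> \<epsilon>(h) 1 = \<epsilon>(h) x \<otimes> 1\<close>. The pushforward of the
  unit is therefore the contraction \<open>?l\<close> of \<open>M \<otimes> H\<close> by the counit,
  followed by tensoring with \<open>1\<close>; counitality says that this contraction sends
  \<open>\<delta> m\<close> to \<open>m\<close>.\<close>

lemma rep_one:
  assumes "counital_coaction k H \<epsilon> M \<delta>"
  shows "\<phi> \<one>\<^bsub>C.C\<^esub> = \<one>\<^bsub>E.E\<^esub>"
proof (rule rep_eqI[OF C.one_closed E.endo_one_closed])
  note b = k_bilinear_swap[OF M.k_bilinear_smult[OF counit_linear]]
  let ?l = "tensor_lift k M H M (\<lambda>x h. \<epsilon> h \<odot>\<^bsub>M\<^esub> x)"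
  show "k_linear k (tensor_module k M H) E.T (\<lambda>t. E.te (?l t) \<one>\<^bsub>A\<^esub>)"
    by (rule k_linear_comp[OF tensor_lift_linear[OF MH E.MA(1) b]
          k_bilinearD(2)[OF tensor_elem_bilinear[OF E.MA] E.A.one_closed]])
  show "E.te (?l (tensor_elem k M H m h)) \<one>\<^bsub>A\<^esub> = E.te m (\<one>\<^bsub>C.C\<^esub> h)"
    if "m \<in> carrier M" "h \<in> carrier H" for m h
    using that k_linearD(1)[OF counit_linear, of h]
    by (simp add: tensor_lift_props(2)[OF MH E.MA(1) b] C.convolution_apply E.te_simps
        base_module_def)
  show "E.te (?l (\<delta> m)) \<one>\<^bsub>A\<^esub> = \<one>\<^bsub>E.E\<^esub> (E.te m \<one>\<^bsub>A\<^esub>)" if "m \<in> carrier M" for m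
    using that assms by (simp add: counital_coaction_def E.endo_apply E.te_closed)
qed

end

theorem theorem5p2:
  fixes k :: "('k, 'z) ring_scheme"
    and A :: "('k, 'a, 'w) module_scheme"
    and H :: "('k, 'h, 'x) module_scheme"
    and M :: "('k, 'm, 'y) module_scheme"
    and weight :: 'k
    and Q :: "'a \<Rightarrow> 'a"
    and \<Delta> :: "'h \<Rightarrow> ('h \<times> 'h \<Rightarrow> 'k) set"
    and \<epsilon> :: "'h \<Rightarrow> 'k"
    and \<delta> :: "'m \<Rightarrow> ('m \<times> 'h \<Rightarrow> 'k) set"
  assumes "cring k"
    and "rota_baxter_algebra k A weight Q"
    and "coalgebra k H \<Delta> \<epsilon>"
    and "right_comodule k H \<Delta> \<epsilon> M \<delta>"
  shows "rota_baxter_algebra k (convolution_algebra k H \<Delta> \<epsilon> A) weight (hom_operator H Q)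
    \<and> rota_baxter_algebra k (endo_algebra k M A) weight (endo_operator k M A Q)
    \<and> rota_baxter_hom_nonunital k
        (convolution_algebra k H \<Delta> \<epsilon> A) (hom_operator H Q)
        (endo_algebra k M A) (endo_operator k M A Q)
        (comodule_rep k H M \<delta> A)
    \<and> (counital_coaction k H \<epsilon> M \<delta> \<longrightarrow>
        rota_baxter_hom k
          (convolution_algebra k H \<Delta> \<epsilon> A) (hom_operator H Q)
          (endo_algebra k M A) (endo_operator k M A Q)
          (comodule_rep k H M \<delta> A))
    \<and> rota_baxter_module k (endo_algebra k M A) weight (endo_operator k M A Q)
        (tensor_module k M A) (\<lambda>g t. g t) (tensor_operator k M A Q)"
proof -
  interpret A: rota_baxter_algebra k A weight Q by fact
  interpret M: right_comodule k H \<Delta> \<epsilon> M \<delta> by fact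
  interpret comodule_rb k H \<Delta> \<epsilon> M \<delta> A weight Q
    by (intro comodule_rb.intro scalar_extension_rb.intro scalar_extension.intro assms
        A.k_algebra_axioms M.M.module_axioms)
  note conv = convolution_rota_baxter[OF assms(3,2)]
  \<comment> \<open>Linearity of the operator on the convolution algebra includes that it maps the
    carrier to itself, which \<open>rep_operator\<close> requires.\<close>
  have "hom_operator H Q f \<in> carrier (convolution_algebra k H \<Delta> \<epsilon> A)"
    if "f \<in> carrier (convolution_algebra k H \<Delta> \<epsilon> A)" for f
    using k_linearD(1)[OF rota_baxter_algebra.operator_linear[OF conv] that] .
  then have "rota_baxter_hom_nonunital k
        (convolution_algebra k H \<Delta> \<epsilon> A) (hom_operator H Q)
        (endo_algebra k M A) (endo_operator k M A Q)
        (comodule_rep k H M \<delta> A)"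
    unfolding rota_baxter_hom_nonunital_def
    by (intro conjI ballI rep_linear rep_mult rep_operator)
  then show ?thesis
    using conv rep_one E.endo_rota_baxter E.endo_rota_baxter_module
    by (simp add: rota_baxter_hom_def)
qed

end
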